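(* Let $X_1,X_2,\ldots$ be i.i.d. standard Gaussian random variables, let $\psi_2(x)=\exp(x^2)-1$, and let $\sigma_{\psi_2}=\|X_1\|_{\psi_2}$. Then, as $n\to\infty$, $$n^{\frac14}\log(n)^{\frac38}\,\big[\widehat\sigma_{\psi_2}(X_1,\ldots,X_n)-\sigma_{\psi_2}\big]\overset{d}{\longrightarrow}\sqrt{\tfrac{2}{27\,\pi^{3/4}}}\;(Y-4),$$ where $Y$ is a fully right-skewed $\beta$-stable random variable with stability index $\beta=\frac43$ and characteristic function $$\mathbb{E}\,e^{\mathbf{i}\lambda Y}=\exp\left(\tfrac43\int_0^\infty\big(e^{\mathbf{i}\lambda x}-1-\mathbf{i}\lambda x\,\mathbf{1}_{x<1}\big)\,x^{-\frac43-1}\,dx\right),\qquad \lambda\in\mathbb{R}.$$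
   Context: For $\psi=\psi_2$ and a real random variable $X$, the Orlicz norm is $\|X\|_\psi=\inf\{\sigma>0 : \mathbb{E}\,\psi(|X|/\sigma)\le 1\}$, and the empirical Orlicz norm of a sample is $$\widehat{\sigma}_\psi(X_1,\ldots,X_n)=\inf\Big\{\sigma>0 : \frac1n\sum_{i=1}^n\psi\Big(\frac{|X_i|}{\sigma}\Big)\le 1\Big\}.$$ *)

theory Defs
  imports "HOL-Probability.Probability"
begin

definition psi2 :: "real \<Rightarrow> real" where
  "psi2 x = exp (x\<^sup>2) - 1"

text \<open>
  Here \<open>\<psi>\<close> is meant to be nonnegative on \<open>[0, \<infinity>)\<close>.
  The expectation is taken as a nonnegative integral, since it may be infinite
  (for a standard Gaussian and \<open>psi2\<close> it is, whenever \<open>\<sigma>\<^sup>2 \<le> 2\<close>), whereas a Bochner integral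
  would then take the default value 0. The infimum is a real one, so the definition is meaningful
  when some \<open>\<sigma>\<close> is admissible, i.e. when the Orlicz norm is finite.
\<close>

definition orlicz_norm :: "'a measure \<Rightarrow> (real \<Rightarrow> real) \<Rightarrow> ('a \<Rightarrow> real) \<Rightarrow> real" where
  "orlicz_norm M \<psi> X = Inf {\<sigma>. \<sigma> > 0 \<and> (\<integral>\<^sup>+ \<omega>. ennreal (\<psi> (\<bar>X \<omega>\<bar> / \<sigma>)) \<partial>M) \<le> 1}"

text \<open>The sample \<open>x\<^sub>1, \<dots>, x\<^sub>n\<close> is given as the sequence \<open>x\<close>, whose entry at index 0 is not used.\<close>

definition empirical_orlicz_norm :: "(real \<Rightarrow> real) \<Rightarrow> nat \<Rightarrow> (nat \<Rightarrow> real) \<Rightarrow> real" where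
  "empirical_orlicz_norm \<psi> n x =
     Inf {\<sigma>. \<sigma> > 0 \<and> 1 / real n * (\<Sum>i=1..n. \<psi> (\<bar>x i\<bar> / \<sigma>)) \<le> 1}"

end

theory Submission
  imports Defs "HOL-Real_Asymp.Real_Asymp"
begin

text \<open>
  Since \<open>\<sigma> \<mapsto> n\<^sup>-\<^sup>1 \<Sum> \<psi>\<^sub>2(\<bar>X\<^sub>i\<bar> / \<sigma>)\<close> is decreasing and continuous, the event
  \<open>r\<^sub>n (\<sigma>' - \<sigma>) \<le> u\<close> for the empirical norm \<open>\<sigma>'\<close>, with \<open>r\<^sub>n = n powr (1/4) * ln n powr (3/8)\<close>, says that
  \<open>\<Sum> exp (X\<^sub>i\<^sup>2 / \<sigma>\<^sub>n\<^sup>2) \<le> 2 n\<close> at \<open>\<sigma>\<^sub>n = \<sigma> + u / r\<^sub>n\<close>. The summands have mean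
  \<open>(1 - 2 / \<sigma>\<^sub>n\<^sup>2) powr (-1/2)\<close>, which at \<open>\<sigma>\<^sup>2 = 8/3\<close> equals 2, and tails of index close to \<open>4/3\<close>.
  After division by \<open>a\<^sub>n = n powr (3/4) * (pi * ln n) powr (-3/8)\<close> the centred sum therefore has a stable limit,
  while the shift of the mean contributes a constant multiple of \<open>u\<close>.
  The stable limit is obtained from characteristic functions: in
  \<open>n * E (g (s exp (X\<^sup>2 / \<sigma>\<^sub>n\<^sup>2) / a\<^sub>n))\<close> with \<open>g x = exp (\<i> x) - 1 - \<i> x\<close>, the affine substitution
  \<open>y = Y\<^sub>n + v / Y\<^sub>n\<close> around the threshold \<open>Y\<^sub>n\<close> where \<open>exp (Y\<^sub>n\<^sup>2 / \<sigma>\<^sub>n\<^sup>2) = a\<^sub>n\<close> turns the Gaussian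
  integral into one that is dominated by a multiple of \<open>exp (- \<bar>v\<bar> / 8)\<close> and converges to
  \<open>\<integral> exp (- v) g (s exp (3 v / 4)) dv\<close>, which is the stable exponent in the variable \<open>x = exp (3 v / 4)\<close>.
  Since the centred limit is \<open>Y - E Y\<close>, the truncation in the exponent of \<open>Y\<close> accounts for \<open>E Y = 4\<close>.
\<close>

subsection \<open>Exponential functionals of a Gaussian\<close>

text \<open>The integrand of a Levy exponent with the linear term removed on the whole line. It is
  quadratic at 0 and at most linear at infinity, hence integrable against a stable Levy density of
  index strictly between 1 and 2, here 4/3.\<close>

definition iexp_rem :: "real \<Rightarrow> complex" where
  "iexp_rem x = iexp x - 1 - \<i> * complex_of_real x"

lemma iexp_rem_measurable [measurable]: "iexp_rem \<in> borel_measurable borel"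
  unfolding iexp_rem_def by measurable

lemma isCont_iexp_rem: "isCont iexp_rem x"
  unfolding iexp_rem_def by (intro continuous_intros)

lemma norm_iexp_rem_le_square: "norm (iexp_rem x) \<le> x\<^sup>2 / 2"
  using iexp_approx1[of x 1] by (simp add: iexp_rem_def diff_diff_eq power2_eq_square)

lemma norm_iexp_rem_le_linear: "norm (iexp_rem x) \<le> 2 * \<bar>x\<bar>"
  using iexp_approx2[of x 1] by (simp add: iexp_rem_def diff_diff_eq)

lemma integrable_exp_neg_abs:
  fixes c :: real
  assumes "c > 0"
  shows "integrable lborel (\<lambda>v. exp (- (c * \<bar>v\<bar>)))"
proof -
  interpret prob_space "density lborel (exponential_density c)"
    using assms by (rule prob_space_exponential_density)
  have "integrable (density lborel (exponential_density c)) (\<lambda>_. 1::real)"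
    by simp
  then have i: "integrable lborel (exponential_density c)"
    using assms by (subst (asm) integrable_density) (auto simp: exponential_density_nonneg)
  have "integrable lborel (\<lambda>v. exponential_density c (0 + (-1) * v))"
    using i by (rule lborel_integrable_real_affine) simp
  \<comment> \<open>The symmetrised density is \<open>exp (- (c * \<bar>v\<bar>))\<close> except for
    the value 2 at \<open>v = 0\<close>, so it serves as a dominating function.\<close>
  with i have "integrable lborel (\<lambda>v. (exponential_density c v + exponential_density c (- v)) / c)"
    by simp
  then show ?thesis
    by (rule Bochner_Integration.integrable_bound)
      (use assms in \<open>auto simp: exponential_density_def field_simps\<close>)
qed

lemma integral_even_half:
  fixes h :: "real \<Rightarrow> 'a :: {banach, second_countable_topology}"
  assumes h: "integrable lborel h" and even: "\<And>y. h (- y) = h y"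
  shows "(\<integral>y. h y \<partial>lborel) = 2 *\<^sub>R (\<integral>y. indicator {0..} y *\<^sub>R h y \<partial>lborel)"
proof -
  have [measurable]: "h \<in> borel_measurable borel"
    using h by auto
  have pos: "integrable lborel (\<lambda>y. indicator {0..} y *\<^sub>R h y)"
    by (rule Bochner_Integration.integrable_bound[OF h]) (auto split: split_indicator)
  have neg: "integrable lborel (\<lambda>y. indicator {..<0} y *\<^sub>R h y)"
    by (rule Bochner_Integration.integrable_bound[OF h]) (auto split: split_indicator)
  have "(\<integral>y. indicator {..<0} y *\<^sub>R h y \<partial>lborel)
      = \<bar>-1\<bar> *\<^sub>R (\<integral>y. indicator {..<0} (0 + (-1) * y) *\<^sub>R h (0 + (-1) * y) \<partial>lborel)"
    by (rule lborel_integral_real_affine) simp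
  also have "\<dots> = (\<integral>y. indicator {0<..} y *\<^sub>R h y \<partial>lborel)"
    by (auto simp: even intro!: Bochner_Integration.integral_cong split: split_indicator)
  also have "\<dots> = (\<integral>y. indicator {0..} y *\<^sub>R h y \<partial>lborel)"
    using AE_lborel_singleton[of 0]
    by (intro integral_cong_AE) (auto split: split_indicator)
  finally have refl: "(\<integral>y. indicator {..<0} y *\<^sub>R h y \<partial>lborel) = (\<integral>y. indicator {0..} y *\<^sub>R h y \<partial>lborel)" .
  have "(\<integral>y. h y \<partial>lborel) = (\<integral>y. indicator {0..} y *\<^sub>R h y + indicator {..<0} y *\<^sub>R h y \<partial>lborel)"
    by (auto intro!: Bochner_Integration.integral_cong split: split_indicator)
  also have "\<dots> = (\<integral>y. indicator {0..} y *\<^sub>R h y \<partial>lborel) + (\<integral>y. indicator {..<0} y *\<^sub>R h y \<partial>lborel)"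
    using pos neg by (rule Bochner_Integration.integral_add)
  finally show ?thesis
    by (simp add: refl scaleR_2)
qed

text \<open>With \<open>c\<^sup>2 = 1 - 2 * q\<close> the integrand is \<open>1 / c\<close> times
  the centred normal density of standard deviation \<open>1 / c\<close>.\<close>

lemma has_bochner_integral_exp_square_normal:
  fixes q :: real
  assumes "q < 1/2"
  shows "has_bochner_integral lborel (\<lambda>y. std_normal_density y * exp (q * y\<^sup>2)) (1 / sqrt (1 - 2 * q))"
proof -
  define c where "c = sqrt (1 - 2 * q)"
  have c: "c > 0" "c\<^sup>2 = 1 - 2 * q"
    using assms by (auto simp: c_def)
  have *: "std_normal_density y * exp (q * y\<^sup>2) = (1 / c) * normal_density 0 (1 / c) y" for y
  proof -
    have "exp (- y\<^sup>2 / 2) * exp (q * y\<^sup>2) = exp (- (c\<^sup>2 * y\<^sup>2) / 2)"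
      by (simp add: c exp_add[symmetric] field_simps)
    then show ?thesis
      using c(1) by (simp add: normal_density_def power_divide real_sqrt_divide field_simps real_sqrt_mult)
  qed
  have "has_bochner_integral lborel (\<lambda>y. (1 / c) * normal_density 0 (1 / c) y) ((1 / c) * 1)"
    using c by (intro has_bochner_integral_mult_right) (auto simp: has_bochner_integral_iff)
  then show ?thesis
    unfolding * c_def by simp
qed

text \<open>For y = Y + v / Y, \<open>p\<close> is the increment of the square from Y to y. Right of
  Y the linear bound leaves \<open>exp ((q - 1/2) * p)\<close>, left of Y the quadratic bound leaves
  \<open>exp ((2 * q - 1/2) * p)\<close>. Both decay as long as q lies strictly between 1/4 and 1/2;
  the window around 3/8 yields the common rate 1/8, uniformly in Y.\<close>

lemma shifted_iexp_rem_bound: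
  fixes q Y v s :: real
  assumes q: "5/16 \<le> q" "q \<le> 7/16" and Y: "Y > 0" and v: "Y + v / Y \<ge> 0"
  defines "p \<equiv> 2 * v + v\<^sup>2 / Y\<^sup>2"
  shows "exp (- p / 2) * norm (iexp_rem (s * exp (q * p))) \<le> (2 * \<bar>s\<bar> + s\<^sup>2 / 2) * exp (- (1/8 * \<bar>v\<bar>))"
proof (cases "v \<ge> 0")
  case True
  have p: "p \<ge> 2 * v"
    by (simp add: p_def)
  have "exp (- p / 2) * norm (iexp_rem (s * exp (q * p))) \<le> exp (- p / 2) * (2 * \<bar>s * exp (q * p)\<bar>)"
    by (intro mult_left_mono norm_iexp_rem_le_linear) simp
  also have "\<dots> = 2 * \<bar>s\<bar> * exp ((q - 1/2) * p)"
    by (simp add: abs_mult exp_add[symmetric] exp_diff field_simps exp_minus)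
  also have "\<dots> \<le> 2 * \<bar>s\<bar> * exp (- (1/8 * \<bar>v\<bar>))"
  proof -
    have "(1/2 - q) * p \<ge> (1/16) * (2 * v)"
      using q p True by (intro mult_mono) auto
    then show ?thesis
      using True by (intro mult_left_mono) (auto simp: algebra_simps)
  qed
  also have "\<dots> \<le> (2 * \<bar>s\<bar> + s\<^sup>2 / 2) * exp (- (1/8 * \<bar>v\<bar>))"
    by (intro mult_right_mono) auto
  finally show ?thesis .
next
  case False
  \<comment> \<open>The restriction to y \<ge> 0 enters here: it keeps the quadratic part of
    \<open>p\<close> below \<open>\<bar>v\<bar>\<close>, so that it cannot outweigh
    \<open>2 * v\<close>.\<close>
  have "v / Y\<^sup>2 \<ge> -1"
    using v Y by (simp add: field_simps power2_eq_square)
  then have "- v * (v / Y\<^sup>2) \<ge> - v * (-1)"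
    using False by (intro mult_left_mono) auto
  then have p: "p \<le> v"
    by (simp add: p_def power2_eq_square)
  have "exp (- p / 2) * norm (iexp_rem (s * exp (q * p))) \<le> exp (- p / 2) * ((s * exp (q * p))\<^sup>2 / 2)"
    by (intro mult_left_mono norm_iexp_rem_le_square) simp
  also have "\<dots> = s\<^sup>2 / 2 * exp ((2 * q - 1/2) * p)"
    by (simp add: power_mult_distrib exp_double[symmetric] exp_add[symmetric] exp_diff field_simps exp_minus)
  also have "\<dots> \<le> s\<^sup>2 / 2 * exp (- (1/8 * \<bar>v\<bar>))"
  proof -
    have "(2 * q - 1/2) * (- p) \<ge> (1/8) * (- v)"
      using q p False by (intro mult_mono) auto
    then show ?thesis
      using False by (intro mult_left_mono) (auto simp: algebra_simps)
  qed
  also have "\<dots> \<le> (2 * \<bar>s\<bar> + s\<^sup>2 / 2) * exp (- (1/8 * \<bar>v\<bar>))"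
    by (intro mult_right_mono) auto
  finally show ?thesis .
qed

text \<open>The linear bound gives the rate 1/4 on the right, the quadratic bound the rate 1/2 on
  the left; the slower one dominates both.\<close>

lemma integrable_exp_iexp_rem:
  "integrable lborel (\<lambda>v. exp (- v) *\<^sub>R iexp_rem (s * exp (3/4 * v)))"
proof (rule Bochner_Integration.integrable_bound)
  show "integrable lborel (\<lambda>v. (2 * \<bar>s\<bar> + s\<^sup>2 / 2) * exp (- (1/4 * \<bar>v\<bar>)))"
    using integrable_exp_neg_abs[of "1/4"] by simp
  have "exp (- v) * norm (iexp_rem (s * exp (3/4 * v))) \<le> (2 * \<bar>s\<bar> + s\<^sup>2 / 2) * exp (- (1/4 * \<bar>v\<bar>))" for v
  proof (cases "v \<ge> 0")
    case True
    have "exp (- v) * norm (iexp_rem (s * exp (3/4 * v))) \<le> exp (- v) * (2 * \<bar>s * exp (3/4 * v)\<bar>)"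
      by (intro mult_left_mono norm_iexp_rem_le_linear) simp
    also have "\<dots> = 2 * \<bar>s\<bar> * (exp (- v) * exp (3/4 * v))"
      by (simp add: abs_mult)
    also have "exp (- v) * exp (3/4 * v) = exp (- (1/4 * \<bar>v\<bar>))"
      using True by (simp add: exp_add[symmetric])
    also have "2 * \<bar>s\<bar> * \<dots> \<le> (2 * \<bar>s\<bar> + s\<^sup>2 / 2) * \<dots>"
      by (intro mult_right_mono) auto
    finally show ?thesis .
  next
    case False
    have "exp (- v) * norm (iexp_rem (s * exp (3/4 * v))) \<le> exp (- v) * ((s * exp (3/4 * v))\<^sup>2 / 2)"
      by (intro mult_left_mono norm_iexp_rem_le_square) simp
    also have "\<dots> = s\<^sup>2 / 2 * (exp (- v) * exp (3/2 * v))"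
      by (simp add: power_mult_distrib exp_double[symmetric])
    also have "\<dots> = s\<^sup>2 / 2 * exp (- (1/2 * \<bar>v\<bar>))"
      using False by (simp add: exp_add[symmetric])
    also have "\<dots> \<le> (2 * \<bar>s\<bar> + s\<^sup>2 / 2) * exp (- (1/4 * \<bar>v\<bar>))"
      by (intro mult_mono) auto
    finally show ?thesis .
  qed
  then show "AE v in lborel. norm (exp (- v) *\<^sub>R iexp_rem (s * exp (3/4 * v)))
      \<le> norm ((2 * \<bar>s\<bar> + s\<^sup>2 / 2) * exp (- (1/4 * \<bar>v\<bar>)))"
    by (intro always_eventually allI) (auto simp: abs_mult intro: order_trans[OF _ abs_ge_self])
qed measurable

lemma integrable_normal_iexp_rem:
  fixes c q :: real
  assumes "q < 1/2"
  shows "integrable lborel (\<lambda>y. std_normal_density y *\<^sub>R iexp_rem (c * exp (q * y\<^sup>2)))"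
proof (rule Bochner_Integration.integrable_bound)
  show "integrable lborel (\<lambda>y. 2 * \<bar>c\<bar> * (std_normal_density y * exp (q * y\<^sup>2)))"
    using has_bochner_integral_exp_square_normal[OF assms]
    by (intro integrable_mult_right) (auto simp: has_bochner_integral_iff)
  show "AE y in lborel. norm (std_normal_density y *\<^sub>R iexp_rem (c * exp (q * y\<^sup>2)))
      \<le> norm (2 * \<bar>c\<bar> * (std_normal_density y * exp (q * y\<^sup>2)))"
  proof (intro always_eventually allI)
    fix y
    have "norm (std_normal_density y *\<^sub>R iexp_rem (c * exp (q * y\<^sup>2)))
        \<le> std_normal_density y * (2 * \<bar>c * exp (q * y\<^sup>2)\<bar>)"
      by (auto intro!: mult_left_mono norm_iexp_rem_le_linear)
    then show "norm (std_normal_density y *\<^sub>R iexp_rem (c * exp (q * y\<^sup>2)))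
      \<le> norm (2 * \<bar>c\<bar> * (std_normal_density y * exp (q * y\<^sup>2)))"
      by (simp add: abs_mult mult_ac)
  qed
qed measurable

text \<open>By evenness only y \<ge> 0 counts. There y = Y + v / Y turns the Gaussian weight into
  its value at Y times a factor close to \<open>exp (- v)\<close>. The map is affine, so its
  Jacobian is the constant \<open>1 / Y\<close>, and the indicator records the cut at y = 0.\<close>

lemma normal_iexp_rem_substitution:
  fixes s q Y :: real
  assumes q: "q < 1/2" and Y: "Y > 0"
  shows "(\<integral>y. std_normal_density y *\<^sub>R iexp_rem (s / exp (q * Y\<^sup>2) * exp (q * y\<^sup>2)) \<partial>lborel)
    = (sqrt (2 / pi) * exp (- Y\<^sup>2 / 2) / Y) *\<^sub>R
      (\<integral>v. indicator {0..} (Y + v / Y) *\<^sub>R exp (- (2 * v + v\<^sup>2 / Y\<^sup>2) / 2) *\<^sub>R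
           iexp_rem (s * exp (q * (2 * v + v\<^sup>2 / Y\<^sup>2))) \<partial>lborel)"
proof -
  define h where "h y = std_normal_density y *\<^sub>R iexp_rem (s / exp (q * Y\<^sup>2) * exp (q * y\<^sup>2))" for y
  define K where "K v = indicator {0..} (Y + v / Y) *\<^sub>R exp (- (2 * v + v\<^sup>2 / Y\<^sup>2) / 2) *\<^sub>R
           iexp_rem (s * exp (q * (2 * v + v\<^sup>2 / Y\<^sup>2)))" for v
  define c where "c = exp (- Y\<^sup>2 / 2) / sqrt (2 * pi)"
  have "(\<integral>y. h y \<partial>lborel) = 2 *\<^sub>R (\<integral>y. indicator {0..} y *\<^sub>R h y \<partial>lborel)"
    unfolding h_def by (intro integral_even_half integrable_normal_iexp_rem q) (simp add: normal_density_def)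
  also have "(\<integral>y. indicator {0..} y *\<^sub>R h y \<partial>lborel)
    = \<bar>1 / Y\<bar> *\<^sub>R (\<integral>v. indicator {0..} (Y + 1 / Y * v) *\<^sub>R h (Y + 1 / Y * v) \<partial>lborel)"
    using Y by (intro lborel_integral_real_affine) simp
  also have "(\<lambda>v. indicator {0..} (Y + 1 / Y * v) *\<^sub>R h (Y + 1 / Y * v)) = (\<lambda>v. c *\<^sub>R K v)"
  proof
    fix v
    define p where "p = 2 * v + v\<^sup>2 / Y\<^sup>2"
    have sq: "(Y + 1 / Y * v)\<^sup>2 = Y\<^sup>2 + p"
      using Y by (simp add: p_def power2_eq_square field_simps)
    have "std_normal_density (Y + 1 / Y * v) = c * exp (- p / 2)"
      unfolding std_normal_density_def sq c_def by (simp add: exp_add[symmetric] field_simps)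
    moreover have "s / exp (q * Y\<^sup>2) * exp (q * (Y\<^sup>2 + p)) = s * exp (q * p)"
      by (simp add: exp_add distrib_left)
    ultimately show "indicator {0..} (Y + 1 / Y * v) *\<^sub>R h (Y + 1 / Y * v) = c *\<^sub>R K v"
      unfolding h_def K_def sq by (simp add: p_def)
  qed
  also have "(\<integral>v. c *\<^sub>R K v \<partial>lborel) = c *\<^sub>R (\<integral>v. K v \<partial>lborel)"
    by simp
  also have "2 *\<^sub>R \<bar>1 / Y\<bar> *\<^sub>R c *\<^sub>R (\<integral>v. K v \<partial>lborel)
    = (sqrt (2 / pi) * exp (- Y\<^sup>2 / 2) / Y) *\<^sub>R (\<integral>v. K v \<partial>lborel)"
  proof -
    have "sqrt (2 / pi) = 2 / sqrt (2 * pi)"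
      by (simp add: real_sqrt_divide real_sqrt_mult field_simps)
    then show ?thesis
      using Y by (simp add: c_def)
  qed
  finally show ?thesis
    unfolding h_def K_def .
qed

text \<open>The weight \<open>\<rho> n\<close> cancels the Gaussian prefactor at the threshold. As
  \<open>Y n\<close> grows, the quadratic part of the exponent vanishes, and twice the limit of
  \<open>q\<close> gives the 3/4.\<close>

lemma normal_iexp_rem_limit:
  fixes s :: real and q Y \<rho> :: "nat \<Rightarrow> real"
  assumes q: "q \<longlonglongrightarrow> 3/8"
    and Y: "filterlim Y at_top sequentially"
    and \<rho>: "(\<lambda>n. \<rho> n * (sqrt (2 / pi) * exp (- (Y n)\<^sup>2 / 2) / Y n)) \<longlonglongrightarrow> 1"
  shows "(\<lambda>n. \<rho> n *\<^sub>R (\<integral>y. std_normal_density y *\<^sub>R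
            iexp_rem (s / exp (q n * (Y n)\<^sup>2) * exp (q n * y\<^sup>2)) \<partial>lborel))
    \<longlonglongrightarrow> (\<integral>v. exp (- v) *\<^sub>R iexp_rem (s * exp (3/4 * v)) \<partial>lborel)"
proof -
  define K where "K n v = indicator {0..} (Y n + v / Y n) *\<^sub>R exp (- (2 * v + v\<^sup>2 / (Y n)\<^sup>2) / 2) *\<^sub>R
           iexp_rem (s * exp (q n * (2 * v + v\<^sup>2 / (Y n)\<^sup>2)))" for n v
  have "eventually (\<lambda>n. 5/16 < q n \<and> q n < 7/16 \<and> 0 < Y n) sequentially"
    using order_tendstoD[OF q, of "5/16"] order_tendstoD[OF q, of "7/16"] Y
    by (auto simp: filterlim_at_top_dense eventually_conj_iff)
  then obtain N where N: "\<And>n. n \<ge> N \<Longrightarrow> 5/16 < q n \<and> q n < 7/16 \<and> 0 < Y n"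
    by (auto simp: eventually_sequentially)
  have lim: "(\<lambda>n. K n v) \<longlonglongrightarrow> exp (- v) *\<^sub>R iexp_rem (s * exp (3/4 * v))" for v
  proof -
    have Yinv: "(\<lambda>n. v\<^sup>2 / (Y n)\<^sup>2) \<longlonglongrightarrow> 0"
      by (intro tendsto_divide_0[OF tendsto_const] filterlim_at_top_imp_at_infinity filterlim_pow_at_top Y) auto
    \<comment> \<open>For fixed \<open>v\<close> the cut at y = 0 eventually has no effect.\<close>
    have "(\<lambda>n. v / Y n) \<longlonglongrightarrow> 0"
      by (intro tendsto_divide_0[OF tendsto_const] filterlim_at_top_imp_at_infinity Y)
    then have "filterlim (\<lambda>n. v / Y n + Y n) at_top sequentially"
      using Y by (rule filterlim_tendsto_add_at_top)
    then have "eventually (\<lambda>n. v / Y n + Y n > 0) sequentially"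
      by (auto simp: filterlim_at_top_dense)
    then have "eventually (\<lambda>n. exp (- (2 * v + v\<^sup>2 / (Y n)\<^sup>2) / 2) *\<^sub>R
           iexp_rem (s * exp (q n * (2 * v + v\<^sup>2 / (Y n)\<^sup>2))) = K n v) sequentially"
      by eventually_elim (simp add: K_def add.commute)
    moreover have "(\<lambda>n. exp (- (2 * v + v\<^sup>2 / (Y n)\<^sup>2) / 2) *\<^sub>R
           iexp_rem (s * exp (q n * (2 * v + v\<^sup>2 / (Y n)\<^sup>2))))
         \<longlonglongrightarrow> exp (- (2 * v + 0) / 2) *\<^sub>R iexp_rem (s * exp (3/8 * (2 * v + 0)))"
      by (intro tendsto_intros Yinv q isCont_tendsto_compose[OF isCont_iexp_rem]) simp_all
    ultimately have "(\<lambda>n. K n v) \<longlonglongrightarrow> exp (- (2 * v + 0) / 2) *\<^sub>R iexp_rem (s * exp (3/8 * (2 * v + 0)))"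
      by (rule Lim_transform_eventually[rotated])
    then show ?thesis by simp
  qed
  have bound: "norm (K n v) \<le> (2 * \<bar>s\<bar> + s\<^sup>2 / 2) * exp (- (1/8 * \<bar>v\<bar>))" if "n \<ge> N" for n v
  proof (cases "Y n + v / Y n \<ge> 0")
    case True
    then show ?thesis
      using shifted_iexp_rem_bound[of "q n" "Y n" v s] N[OF that] by (simp add: K_def)
  qed (simp add: K_def)
  \<comment> \<open>The dominating function is available only from \<open>N\<close> on, so the limit
    is taken along the shifted sequence.\<close>
  have "(\<lambda>n. \<integral>v. K (n + N) v \<partial>lborel) \<longlonglongrightarrow> (\<integral>v. exp (- v) *\<^sub>R iexp_rem (s * exp (3/4 * v)) \<partial>lborel)"
  proof (rule integral_dominated_convergence)
    show "integrable lborel (\<lambda>v. (2 * \<bar>s\<bar> + s\<^sup>2 / 2) * exp (- (1/8 * \<bar>v\<bar>)))"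
      using integrable_exp_neg_abs[of "1/8"] by simp
    show "AE v in lborel. (\<lambda>n. K (n + N) v) \<longlonglongrightarrow> exp (- v) *\<^sub>R iexp_rem (s * exp (3/4 * v))"
      using LIMSEQ_ignore_initial_segment[OF lim] by simp
    show "AE v in lborel. norm (K (n + N) v) \<le> (2 * \<bar>s\<bar> + s\<^sup>2 / 2) * exp (- (1/8 * \<bar>v\<bar>))" for n
      using bound[of "n + N"] by simp
  qed (auto simp: K_def)
  then have "(\<lambda>n. \<integral>v. K n v \<partial>lborel) \<longlonglongrightarrow> (\<integral>v. exp (- v) *\<^sub>R iexp_rem (s * exp (3/4 * v)) \<partial>lborel)"
    by (rule LIMSEQ_offset)
  from tendsto_scaleR[OF \<rho> this]
  have "(\<lambda>n. (\<rho> n * (sqrt (2 / pi) * exp (- (Y n)\<^sup>2 / 2) / Y n)) *\<^sub>R (\<integral>v. K n v \<partial>lborel))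
    \<longlonglongrightarrow> (\<integral>v. exp (- v) *\<^sub>R iexp_rem (s * exp (3/4 * v)) \<partial>lborel)"
    by simp
  moreover have "eventually (\<lambda>n. (\<rho> n * (sqrt (2 / pi) * exp (- (Y n)\<^sup>2 / 2) / Y n)) *\<^sub>R (\<integral>v. K n v \<partial>lborel)
      = \<rho> n *\<^sub>R (\<integral>y. std_normal_density y *\<^sub>R
            iexp_rem (s / exp (q n * (Y n)\<^sup>2) * exp (q n * y\<^sup>2)) \<partial>lborel)) sequentially"
    using eventually_ge_at_top[of N]
  proof eventually_elim
    case (elim n)
    show ?case
      using N[OF elim] by (subst normal_iexp_rem_substitution) (auto simp: K_def[abs_def])
  qed
  ultimately show ?thesis
    by (rule Lim_transform_eventually)
qed

text \<open>Complex logarithms are avoided: two numbers a, b of the closed unit disc satisfy |a^n -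
  b^n| \<le> n |a - b|, and this is applied to \<open>w n\<close> and
  \<open>exp (L / n)\<close>.\<close>

lemma tendsto_power_exp:
  fixes w :: "nat \<Rightarrow> complex"
  assumes w: "(\<lambda>n. of_nat n * (w n - 1)) \<longlonglongrightarrow> L"
    and norm: "eventually (\<lambda>n. norm (w n) \<le> 1) sequentially"
  shows "(\<lambda>n. w n ^ n) \<longlonglongrightarrow> exp L"
proof -
  \<comment> \<open>Needed to place \<open>exp (L / n)\<close> in the unit disc.\<close>
  have ReL: "Re L \<le> 0"
  proof (rule tendsto_upperbound[OF tendsto_Re[OF w]])
    show "eventually (\<lambda>n. Re (of_nat n * (w n - 1)) \<le> 0) sequentially"
      using norm
    proof eventually_elim
      case (elim n)
      have "Re (w n) \<le> 1"
        using complex_Re_le_cmod[of "w n"] elim by linarith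
      then show ?case
        by (simp add: mult_nonneg_nonpos)
    qed
  qed simp
  \<comment> \<open>The derivative at 0, read along h = 1 / n, shows that \<open>exp (L / n)\<close>
    has the same first-order behaviour as \<open>w n\<close>.\<close>
  have "((\<lambda>h. exp (h * L)) has_field_derivative L) (at 0)"
    by (auto intro!: derivative_eq_intros)
  then have "((\<lambda>h. (exp (h * L) - 1) / h) \<longlongrightarrow> L) (at 0)"
    by (simp add: has_field_derivative_iff)
  moreover have "filterlim (\<lambda>n. inverse (of_nat n :: complex)) (at 0) sequentially"
    by (auto simp: filterlim_at intro!: tendsto_inverse_0[THEN filterlim_compose] tendsto_of_nat eventually_at_top_not_equal eventually_gt_at_top[THEN eventually_mono])
  ultimately have "(\<lambda>n. (exp (inverse (of_nat n) * L) - 1) / inverse (of_nat n)) \<longlonglongrightarrow> L"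
    by (rule filterlim_compose)
  then have "(\<lambda>n. of_nat n * (exp (L / of_nat n) - 1)) \<longlonglongrightarrow> L"
    by (simp add: field_simps)
  from tendsto_norm_zero[OF Lim_null[THEN iffD1, OF tendsto_diff[OF w this]], simplified]
  have *: "(\<lambda>n. norm (of_nat n * (w n - 1) - of_nat n * (exp (L / of_nat n) - 1))) \<longlonglongrightarrow> 0"
    by simp
  have "eventually (\<lambda>n. norm (w n ^ n - exp L)
      \<le> norm (of_nat n * (w n - 1) - of_nat n * (exp (L / of_nat n) - 1))) sequentially"
    using eventually_gt_at_top[of 0] norm
  proof eventually_elim
    case (elim n)
    have "norm (w n ^ n - exp (L / of_nat n) ^ n) \<le> n * norm (w n - exp (L / of_nat n))"
      using elim ReL by (intro norm_power_diff) (auto simp: norm_exp_eq_Re Re_divide_of_nat divide_nonpos_nonneg)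
    also have "exp (L / of_nat n) ^ n = exp L"
      using elim by (simp add: exp_of_nat_mult[symmetric])
    also have "real n * norm (w n - exp (L / of_nat n)) = norm (of_nat n * (w n - exp (L / of_nat n)))"
      by (simp add: norm_mult)
    also have "of_nat n * (w n - exp (L / of_nat n)) = of_nat n * (w n - 1) - of_nat n * (exp (L / of_nat n) - 1)"
      by (simp add: algebra_simps)
    finally show ?case .
  qed
  from Lim_null_comparison[OF this *] show ?thesis
    using Lim_null by blast
qed

subsection \<open>Orlicz norms for \<open>\<psi>\<^sub>2\<close>\<close>

text \<open>The admissible scales form an up-set because the empirical mean decreases in the scale,
  and continuity makes every positive infimum admissible. The set is non-empty because the mean
  tends to 0 for large scales.\<close>

lemma empirical_orlicz_norm_psi2_le_iff:
  assumes s: "s > 0"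
  shows "empirical_orlicz_norm psi2 n x \<le> s \<longleftrightarrow> 1 / real n * (\<Sum>i=1..n. psi2 (\<bar>x i\<bar> / s)) \<le> 1"
proof -
  define f where "f \<sigma> = 1 / real n * (\<Sum>i=1..n. psi2 (\<bar>x i\<bar> / \<sigma>))" for \<sigma>
  define S where "S = {\<sigma>. \<sigma> > 0 \<and> f \<sigma> \<le> 1}"
  have emp: "empirical_orlicz_norm psi2 n x = Inf S"
    by (simp add: empirical_orlicz_norm_def S_def f_def)
  have bdd: "bdd_below S"
    by (auto simp: S_def intro!: bdd_belowI[of _ 0])
  have anti: "f \<tau> \<le> f \<sigma>" if "0 < \<sigma>" "\<sigma> \<le> \<tau>" for \<sigma> \<tau>
    unfolding f_def psi2_def using that
    by (intro mult_left_mono sum_mono diff_right_mono) (auto intro!: power_mono divide_left_mono)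
  have "(f \<longlongrightarrow> 1 / real n * (\<Sum>i=1..n. exp (0\<^sup>2) - 1)) at_top"
    unfolding f_def psi2_def
    by (intro tendsto_intros tendsto_divide_0[OF tendsto_const] filterlim_at_top_imp_at_infinity filterlim_ident)
  then have "(f \<longlongrightarrow> 0) at_top"
    by simp
  then have "eventually (\<lambda>\<sigma>. f \<sigma> < 1) at_top"
    by (rule order_tendstoD) simp
  then have "eventually (\<lambda>\<sigma>. \<sigma> \<in> S) at_top"
    using eventually_gt_at_top[of 0] by eventually_elim (simp add: S_def)
  then have ne: "S \<noteq> {}"
    by (auto simp: eventually_at_top_linorder)
  show ?thesis
    unfolding emp f_def[symmetric]
  proof
    assume "f s \<le> 1"
    then show "Inf S \<le> s"
      using s bdd by (intro cInf_lower) (auto simp: S_def)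
  next
    assume le: "Inf S \<le> s"
    \<comment> \<open>Everything strictly above \<open>s\<close> is admissible by monotonicity;
      right continuity then reaches \<open>s\<close> itself.\<close>
    have gt: "f \<tau> \<le> 1" if "\<tau> > s" for \<tau>
    proof -
      have "Inf S < \<tau>"
        using le that by linarith
      then obtain \<sigma> where "\<sigma> \<in> S" "\<sigma> < \<tau>"
        using cInf_less_iff[OF ne bdd] by blast
      then show ?thesis
        using anti[of \<sigma> \<tau>] by (auto simp: S_def)
    qed
    have "continuous (at_right s) f"
      unfolding f_def psi2_def using s by (intro continuous_intros) auto
    then have "(f \<longlongrightarrow> f s) (at_right s)"
      by (simp add: continuous_within)
    moreover have "eventually (\<lambda>\<tau>. f \<tau> \<le> 1) (at_right s)"
      using gt by (auto simp: eventually_at_filter)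
    ultimately show "f s \<le> 1"
      by (rule tendsto_upperbound) simp
  qed
qed

lemma empirical_orlicz_norm_psi2_nonneg: "empirical_orlicz_norm psi2 n x \<ge> 0"
proof (rule ccontr)
  assume neg': "\<not> ?thesis"
  define S where "S = {\<sigma>. \<sigma> > 0 \<and> 1 / real n * (\<Sum>i=1..n. psi2 (\<bar>x i\<bar> / \<sigma>)) \<le> 1}"
  have neg: "Inf S < 0"
    using neg' by (simp add: empirical_orlicz_norm_def S_def)
  \<comment> \<open>A negative infimum would make every positive scale admissible, but the infimum
    of all positive numbers is 0.\<close>
  have le: "1 / real n * (\<Sum>i=1..n. psi2 (\<bar>x i\<bar> / \<sigma>)) \<le> 1" if "\<sigma> > 0" for \<sigma>
    using empirical_orlicz_norm_psi2_le_iff[OF that, of n x] neg' that by linarith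
  then have "S = {0<..}"
    by (auto simp: S_def)
  then show False
    using neg by simp
qed

lemma empirical_orlicz_norm_psi2_measurable:
  assumes [measurable]: "\<And>i. i \<in> {1..n} \<Longrightarrow> X i \<in> borel_measurable M"
  shows "(\<lambda>\<omega>. empirical_orlicz_norm psi2 n (\<lambda>i. X i \<omega>)) \<in> borel_measurable M"
proof (rule borel_measurableI_le)
  fix y :: real
  have pos: "{\<omega> \<in> space M. empirical_orlicz_norm psi2 n (\<lambda>i. X i \<omega>) \<le> s} \<in> sets M" if "s > 0" for s
    unfolding empirical_orlicz_norm_psi2_le_iff[OF that] psi2_def by measurable
  consider "y > 0" | "y = 0" | "y < 0" by linarith
  then show "{\<omega> \<in> space M. empirical_orlicz_norm psi2 n (\<lambda>i. X i \<omega>) \<le> y} \<in> sets M"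
  proof cases
    case 1
    then show ?thesis by (rule pos)
  next
    case 2
    \<comment> \<open>The description of sublevel sets by sums requires a positive level, so level 0
      is reached as a countable intersection.\<close>
    have "{\<omega> \<in> space M. empirical_orlicz_norm psi2 n (\<lambda>i. X i \<omega>) \<le> y}
        = (\<Inter>k. {\<omega> \<in> space M. empirical_orlicz_norm psi2 n (\<lambda>i. X i \<omega>) \<le> inverse (real (Suc k))})"
    proof safe
      fix \<omega> k
      assume "empirical_orlicz_norm psi2 n (\<lambda>i. X i \<omega>) \<le> y"
      then show "empirical_orlicz_norm psi2 n (\<lambda>i. X i \<omega>) \<le> inverse (real (Suc k))"
        using 2 by (meson inverse_nonnegative_iff_nonnegative of_nat_0_le_iff order_trans order_refl)
    next
      fix \<omega>
      assume "\<omega> \<in> (\<Inter>k. {\<omega> \<in> space M. empirical_orlicz_norm psi2 n (\<lambda>i. X i \<omega>) \<le> inverse (real (Suc k))})"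
      then have "\<And>k. empirical_orlicz_norm psi2 n (\<lambda>i. X i \<omega>) \<le> inverse (real (Suc k))"
        by auto
      then show "empirical_orlicz_norm psi2 n (\<lambda>i. X i \<omega>) \<le> y"
        unfolding 2 by (intro LIMSEQ_le_const[OF LIMSEQ_inverse_real_of_nat]) auto
    qed auto
    also have "\<dots> \<in> sets M"
      using pos by (intro sets.countable_INT) auto
    finally show ?thesis .
  next
    case 3
    have "\<not> empirical_orlicz_norm psi2 n (\<lambda>i. X i \<omega>) \<le> y" for \<omega>
      using 3 empirical_orlicz_norm_psi2_nonneg[of n "\<lambda>i. X i \<omega>"] by linarith
    then show ?thesis by simp
  qed
qed

lemma nn_integral_psi2_std_normal:
  assumes X: "distributed M lborel X std_normal_density" and \<sigma>: "\<sigma> > 0" "\<sigma>\<^sup>2 > 2"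
  shows "(\<integral>\<^sup>+ \<omega>. ennreal (psi2 (\<bar>X \<omega>\<bar> / \<sigma>)) \<partial>M) = ennreal (1 / sqrt (1 - 2 / \<sigma>\<^sup>2) - 1)"
proof -
  have "(\<integral>\<^sup>+ \<omega>. ennreal (psi2 (\<bar>X \<omega>\<bar> / \<sigma>)) \<partial>M)
      = (\<integral>\<^sup>+ y. ennreal (std_normal_density y) * ennreal (psi2 (\<bar>y\<bar> / \<sigma>)) \<partial>lborel)"
    using distributed_nn_integral[OF X, of "\<lambda>y. ennreal (psi2 (\<bar>y\<bar> / \<sigma>))"]
    by (simp add: psi2_def)
  also have "\<dots> = (\<integral>\<^sup>+ y. ennreal (std_normal_density y * exp (1 / \<sigma>\<^sup>2 * y\<^sup>2) - std_normal_density y) \<partial>lborel)"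
    by (simp add: psi2_def ennreal_mult'[symmetric] power_divide algebra_simps)
  also have "\<dots> = ennreal (1 / sqrt (1 - 2 * (1 / \<sigma>\<^sup>2)) - 1)"
  proof (rule nn_integral_eq_integral[THEN trans])
    have q: "1 / \<sigma>\<^sup>2 < 1 / 2"
      using \<sigma> by (simp add: field_simps)
    note e = has_bochner_integral_exp_square_normal[OF q]
    show "integrable lborel (\<lambda>y. std_normal_density y * exp (1 / \<sigma>\<^sup>2 * y\<^sup>2) - std_normal_density y)"
      using e by (auto simp: has_bochner_integral_iff)
    show "AE y in lborel. 0 \<le> std_normal_density y * exp (1 / \<sigma>\<^sup>2 * y\<^sup>2) - std_normal_density y"
      using mult_left_mono[of 1 _ "std_normal_density _"] by auto
    show "ennreal (\<integral>y. std_normal_density y * exp (1 / \<sigma>\<^sup>2 * y\<^sup>2) - std_normal_density y \<partial>lborel)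
        = ennreal (1 / sqrt (1 - 2 * (1 / \<sigma>\<^sup>2)) - 1)"
      using e by (auto simp: has_bochner_integral_iff)
  qed
  finally show ?thesis by simp
qed

text \<open>The expectation equals 1 exactly when 1 - 2 / \<open>\<sigma>\<^sup>2\<close> is 1/4,
  that is at \<open>\<sigma>\<^sup>2 = 8/3\<close>; monotonicity decides all other scales.\<close>

lemma orlicz_norm_psi2_std_normal:
  assumes X: "distributed M lborel X std_normal_density"
  shows "orlicz_norm M psi2 X = sqrt (8/3)"
proof -
  define I where "I \<sigma> = (\<integral>\<^sup>+ \<omega>. ennreal (psi2 (\<bar>X \<omega>\<bar> / \<sigma>)) \<partial>M)" for \<sigma>
  have I: "I \<sigma> = ennreal (1 / sqrt (1 - 2 / \<sigma>\<^sup>2) - 1)" if "\<sigma> > 0" "\<sigma>\<^sup>2 > 2" for \<sigma>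
    unfolding I_def using X that by (rule nn_integral_psi2_std_normal)
  have anti: "I \<tau> \<le> I \<sigma>" if "0 < \<sigma>" "\<sigma> \<le> \<tau>" for \<sigma> \<tau>
    unfolding I_def psi2_def using that
    by (intro nn_integral_mono ennreal_leI diff_right_mono) (auto intro!: power_mono divide_left_mono)
  have at: "I (sqrt (8/3)) = 1"
  proof -
    have sq: "(sqrt (8/3))\<^sup>2 = (8/3 :: real)"
      by (rule real_sqrt_pow2) simp
    have half: "sqrt (1 - 2 / (8/3)) = (1/2 :: real)"
      by (intro real_sqrt_unique) (simp_all add: power2_eq_square)
    show ?thesis
      using I[of "sqrt (8/3)"] unfolding sq half by simp
  qed
  have below: "I \<sigma> > 1" if \<sigma>: "0 < \<sigma>" "\<sigma> < sqrt (8/3)" for \<sigma>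
  proof -
    \<comment> \<open>The closed form is valid only for squares above 2. Raising the scale to at
      least \<open>sqrt (7/3)\<close>, between \<open>sqrt 2\<close> and \<open>sqrt (8/3)\<close>,
      makes it usable, and monotonicity carries the bound back to \<open>\<sigma>\<close>.\<close>
    define \<tau> where "\<tau> = max \<sigma> (sqrt (7/3))"
    have \<tau>: "\<tau> \<ge> \<sigma>" "\<tau> \<ge> sqrt (7/3)" "\<tau> < sqrt (8/3)"
      using \<sigma> by (auto simp: \<tau>_def)
    have "\<tau> > 0"
      using \<tau> \<sigma> by linarith
    have "\<tau>\<^sup>2 \<ge> 7/3"
      using power_mono[OF \<tau>(2), of 2] by simp
    have "\<tau>\<^sup>2 < 8/3"
      using power_strict_mono[OF \<tau>(3), of 2] \<open>\<tau> > 0\<close> by simp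
    have "1 - 2 / \<tau>\<^sup>2 < (1/2)\<^sup>2" "1 - 2 / \<tau>\<^sup>2 > 0"
      using \<open>\<tau>\<^sup>2 \<ge> 7/3\<close> \<open>\<tau>\<^sup>2 < 8/3\<close> \<open>\<tau> > 0\<close> by (simp_all add: power_divide field_simps)
    then have "sqrt (1 - 2 / \<tau>\<^sup>2) < 1/2" "sqrt (1 - 2 / \<tau>\<^sup>2) > 0"
      using real_sqrt_less_mono[of "1 - 2 / \<tau>\<^sup>2" "(1/2)\<^sup>2"] by simp_all
    then have "1 / sqrt (1 - 2 / \<tau>\<^sup>2) - 1 > 1"
      by (simp add: field_simps)
    then have "ennreal 1 < I \<tau>"
      using \<open>\<tau> > 0\<close> \<open>\<tau>\<^sup>2 \<ge> 7/3\<close> by (subst I) (auto simp: ennreal_less_iff simp del: ennreal_1)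
    also have "I \<tau> \<le> I \<sigma>"
      using \<sigma> \<tau> by (intro anti) auto
    finally show ?thesis by simp
  qed
  have "{\<sigma>. \<sigma> > 0 \<and> I \<sigma> \<le> 1} = {sqrt (8/3)..}"
  proof (intro set_eqI iffI)
    fix \<sigma> assume "\<sigma> \<in> {\<sigma>. \<sigma> > 0 \<and> I \<sigma> \<le> 1}"
    then show "\<sigma> \<in> {sqrt (8/3)..}"
      using below[of \<sigma>] by (cases "\<sigma> < sqrt (8/3)") auto
  next
    fix \<sigma> assume "\<sigma> \<in> {sqrt (8/3)..}"
    then have "sqrt (8/3) \<le> \<sigma>" by simp
    moreover from this have "0 < \<sigma>"
      by (rule less_le_trans[rotated]) simp
    ultimately show "\<sigma> \<in> {\<sigma>. \<sigma> > 0 \<and> I \<sigma> \<le> 1}"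
      using anti[of "sqrt (8/3)" \<sigma>] at by auto
  qed
  then show ?thesis
    by (simp add: orlicz_norm_def I_def)
qed

subsection \<open>The exponent of the stable law\<close>

text \<open>Put x = exp (3 v / 4): the density contributes \<open>exp (- 7/4 * v)\<close> and the
  Jacobian \<open>3/4 * exp (3/4 * v)\<close>, so the weight \<open>exp (- v)\<close> remains and
  the factor 4/3 cancels.\<close>

lemma stable_substitution:
  fixes t :: real
  shows "set_integrable lborel {0<..} (\<lambda>x. (x powr (-(4/3) - 1)) *\<^sub>R iexp_rem (t * x))"
    and "4/3 * (CLBINT x:{0<..}. (x powr (-(4/3) - 1)) *\<^sub>R iexp_rem (t * x))
      = (\<integral>v. exp (- v) *\<^sub>R iexp_rem (t * exp (3/4 * v)) \<partial>lborel)"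
proof -
  define f where "f x = (x powr (-(4/3) - 1)) *\<^sub>R iexp_rem (t * x)" for x
  define g where "g v = exp (3/4 * v)" for v :: real
  define g' where "g' v = 3/4 * exp (3/4 * v)" for v :: real
  have gf: "g' v *\<^sub>R f (g v) = (3/4) *\<^sub>R (exp (- v) *\<^sub>R iexp_rem (t * exp (3/4 * v)))" for v
    by (simp add: f_def g_def g'_def powr_def mult_exp_exp)
  have deriv: "DERIV g v :> g' v" for v
    unfolding g_def g'_def by (auto intro!: derivative_eq_intros)
  have isCont_rem: "isCont (\<lambda>x. iexp_rem (t * x)) x" for x
    by (intro continuous_intros isCont_o2[OF _ isCont_iexp_rem])
  have contf: "isCont f (g v)" for v
    unfolding f_def g_def by (intro continuous_intros isCont_rem) auto
  have contg': "isCont g' v" for v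
    unfolding g'_def by (intro continuous_intros)
  have A: "((ereal \<circ> g \<circ> real_of_ereal) \<longlongrightarrow> 0) (at_right (-\<infinity>))"
  proof -
    have "(g \<longlongrightarrow> 0) at_bot"
      unfolding g_def by real_asymp
    then show ?thesis
      unfolding ereal_tendsto_simps by (simp add: comp_def zero_ereal_def)
  qed
  have B: "((ereal \<circ> g \<circ> real_of_ereal) \<longlongrightarrow> \<infinity>) (at_left \<infinity>)"
  proof -
    have "filterlim g at_top at_top"
      unfolding g_def by real_asymp
    then show ?thesis
      unfolding ereal_tendsto_simps by (simp add: comp_def tendsto_PInfty_eq_at_top)
  qed
  have int: "set_integrable lborel (einterval (-\<infinity>) \<infinity>) (\<lambda>v. g' v *\<^sub>R f (g v))"
    unfolding gf set_integrable_def using integrable_exp_iexp_rem[of t]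
    by (intro integrable_mult_indicator integrable_scaleR_right) auto
  \<comment> \<open>Substitution for the complex integrand presupposes integrability on both sides.
    The rule for nonnegative functions, applied to the norm, supplies it in the variable x.\<close>
  have "set_integrable lborel (einterval 0 \<infinity>) (\<lambda>x. norm (f x))"
  proof (rule interval_integral_substitution_nonneg(1)[OF _ deriv _ contg' _ _ A B])
    have "(\<lambda>v. norm (f (g v)) * g' v) = (\<lambda>v. norm (g' v *\<^sub>R f (g v)))"
      by (auto simp: g'_def)
    with set_integrable_norm[OF int]
    show "set_integrable lborel (einterval (-\<infinity>) \<infinity>) (\<lambda>v. norm (f (g v)) * g' v)"
      by simp
  qed (auto simp: g'_def intro!: continuous_norm contf)
  then have "set_integrable lborel {0<..} (\<lambda>x. norm (f x))"
    by (simp add: zero_ereal_def)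
  then have fi: "set_integrable lborel {0<..} f"
    by (rule set_integrable_bound) (auto simp: f_def set_borel_measurable_def)
  then show "set_integrable lborel {0<..} (\<lambda>x. (x powr (-(4/3) - 1)) *\<^sub>R iexp_rem (t * x))"
    by (simp add: f_def[abs_def])
  have "(LBINT x=0..\<infinity>. f x) = (LBINT v=-\<infinity>..\<infinity>. g' v *\<^sub>R f (g v))"
  proof (rule interval_integral_substitution_integrable[OF _ deriv contf contg' _ A B int])
    show "set_integrable lborel (einterval 0 \<infinity>) f"
      using fi by (simp add: zero_ereal_def)
  qed (auto simp: g'_def)
  then have "(CLBINT x:{0<..}. f x) = (LBINT v=-\<infinity>..\<infinity>. g' v *\<^sub>R f (g v))"
    by (simp only: interval_lebesgue_integral_0_infty)
  also have "\<dots> = (\<integral>v. g' v *\<^sub>R f (g v) \<partial>lborel)"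
    by (simp add: interval_lebesgue_integral_def set_lebesgue_integral_def)
  also have "\<dots> = (3/4) *\<^sub>R (\<integral>v. exp (- v) *\<^sub>R iexp_rem (t * exp (3/4 * v)) \<partial>lborel)"
    unfolding gf by (rule integral_scaleR_right)
  finally have "(CLBINT x:{0<..}. f x) = (3/4) *\<^sub>R (\<integral>v. exp (- v) *\<^sub>R iexp_rem (t * exp (3/4 * v)) \<partial>lborel)" .
  then show "4/3 * (CLBINT x:{0<..}. (x powr (-(4/3) - 1)) *\<^sub>R iexp_rem (t * x))
      = (\<integral>v. exp (- v) *\<^sub>R iexp_rem (t * exp (3/4 * v)) \<partial>lborel)"
    unfolding f_def by (simp add: scaleR_conv_of_real mult.commute)
qed

lemma has_bochner_integral_powr_tail:
  "has_bochner_integral lborel (\<lambda>x. x powr (-(4/3)) * indicator {1..} x) (3::real)"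
proof (rule has_bochner_integral_nn_integral)
  have "(\<integral>\<^sup>+x. ennreal (x powr (-(4/3))) * indicator {1..} x \<partial>lborel) = ennreal (0 - (- 3 * 1 powr (-(1/3))))"
  proof (rule nn_integral_FTC_atLeast[where F = "\<lambda>x. - 3 * x powr (-(1/3))"])
    show "((\<lambda>x::real. - 3 * x powr (-(1/3))) \<longlongrightarrow> 0) at_top"
      by real_asymp
    show "((\<lambda>x. - 3 * x powr (-(1/3))) has_real_derivative x powr (-(4/3))) (at x)" if "1 \<le> x" for x :: real
      using that by (auto intro!: derivative_eq_intros)
  qed auto
  then show "(\<integral>\<^sup>+x. ennreal (x powr (-(4/3)) * indicator {1..} x) \<partial>lborel) = ennreal 3"
    by (simp add: ennreal_mult' ennreal_indicator)
qed auto

text \<open>The truncated and the fully compensated integrands differ by the linear term on [1,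
  \<infinity>), where \<open>x powr (-(4/3))\<close> has integral 3. Multiplied by 4/3 this gives
  the centring constant 4.\<close>

lemma stable_exponent_eq:
  fixes t :: real
  shows "4/3 * (CLBINT x:{0<..}.
             (exp (\<i> * of_real t * of_real x) - 1 - \<i> * of_real t * of_real x * indicator {..<1} x)
               * of_real (x powr (- (4/3) - 1)))
    = (\<integral>v. exp (- v) *\<^sub>R iexp_rem (t * exp (3/4 * v)) \<partial>lborel) + 4 * \<i> * of_real t"
proof -
  define c where "c x = (\<i> * of_real t) * complex_of_real (x powr (-(4/3)) * indicator {1..} x)" for x :: real
  have c: "has_bochner_integral lborel c (\<i> * of_real t * of_real 3)"
    unfolding c_def
    by (intro has_bochner_integral_mult_right has_bochner_integral_of_real has_bochner_integral_powr_tail)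
  have eq: "(exp (\<i> * of_real t * of_real x) - 1 - \<i> * of_real t * of_real x * indicator {..<1} x)
               * of_real (x powr (- (4/3) - 1))
     = (x powr (-(4/3) - 1)) *\<^sub>R iexp_rem (t * x) + c x" if "x \<in> {0<..}" for x
  proof -
    have "x powr (-(4/3)) = x * x powr (-(4/3) - 1)"
      using that by (simp add: powr_mult_base)
    then show ?thesis
      by (auto simp: c_def iexp_rem_def scaleR_conv_of_real algebra_simps split: split_indicator)
  qed
  have ci: "set_integrable lborel {0<..} c"
    unfolding set_integrable_def using c by (intro integrable_mult_indicator) (auto simp: has_bochner_integral_iff)
  have "(CLBINT x:{0<..}. c x) = integral\<^sup>L lborel c"
    unfolding set_lebesgue_integral_def
    by (intro Bochner_Integration.integral_cong) (auto simp: c_def split: split_indicator)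
  then have c3: "(CLBINT x:{0<..}. c x) = 3 * \<i> * of_real t"
    using c by (simp add: has_bochner_integral_iff)
  have "(CLBINT x:{0<..}.
             (exp (\<i> * of_real t * of_real x) - 1 - \<i> * of_real t * of_real x * indicator {..<1} x)
               * of_real (x powr (- (4/3) - 1)))
     = (CLBINT x:{0<..}. (x powr (-(4/3) - 1)) *\<^sub>R iexp_rem (t * x) + c x)"
    by (intro set_lebesgue_integral_cong allI impI eq) auto
  also have "\<dots> = (CLBINT x:{0<..}. (x powr (-(4/3) - 1)) *\<^sub>R iexp_rem (t * x)) + 3 * \<i> * of_real t"
    using stable_substitution(1)[of t] ci by (subst set_integral_add(2)) (simp_all only: c3)
  finally show ?thesis
    by (simp only: distrib_left stable_substitution(2)) simp
qed

subsection \<open>Normalising sequences\<close>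

definition rate :: "nat \<Rightarrow> real" where
  "rate n = real n powr (1/4) * ln (real n) powr (3/8)"

text \<open>The norming sequence for which n times the Gaussian tail approximation of P(exp (3 X^2 /
  8) > a) tends to 1.\<close>

definition stable_scale :: "nat \<Rightarrow> real" where
  "stable_scale n = real n powr (3/4) * (pi * ln (real n)) powr (-(3/8))"

text \<open>This is \<open>pi powr (-(3/8))\<close> divided by \<open>sqrt (27/2)\<close>, the
  absolute slope of the mean of the summands at the Orlicz norm: fluctuations of the sum become
  fluctuations of the scale through this slope.\<close>

definition limit_factor :: real where
  "limit_factor = sqrt (2 / (27 * pi powr (3/4)))"

lemma limit_factor_pos: "limit_factor > 0"
  by (simp add: limit_factor_def)

lemma rate_at_top: "filterlim rate at_top sequentially"
  unfolding rate_def by real_asymp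

lemma stable_scale_at_top: "filterlim stable_scale at_top sequentially"
  unfolding stable_scale_def by real_asymp

lemma eventually_stable_scale_gt_1: "eventually (\<lambda>n. stable_scale n > 1) sequentially"
  using stable_scale_at_top by (simp add: filterlim_at_top_dense)

lemma ln_stable_scale_at_top: "filterlim (\<lambda>n. ln (stable_scale n)) at_top sequentially"
  unfolding stable_scale_def by real_asymp

text \<open>Moving the scale by \<open>u / rate n\<close> changes half the squared threshold by a
  bounded multiple of this ratio, so the tail at the threshold is asymptotically unaffected.\<close>

lemma ln_stable_scale_over_rate: "(\<lambda>n. ln (stable_scale n) / rate n) \<longlonglongrightarrow> 0"
  unfolding stable_scale_def rate_def by real_asymp

text \<open>Makes the accumulated shift of n means, each of order \<open>1 / rate n\<close>,
  comparable to the stable fluctuations. The powers of n and of the logarithm cancel, leaving only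
  the power of pi.\<close>

lemma scale_rate_balance: "(\<lambda>n. real n / (stable_scale n * rate n)) \<longlonglongrightarrow> pi powr (3/8)"
  unfolding stable_scale_def rate_def by real_asymp (simp add: powr_minus)

lemma linear_over_stable_scale_square: "(\<lambda>n. real n / (stable_scale n)\<^sup>2) \<longlonglongrightarrow> 0"
  unfolding stable_scale_def by real_asymp

lemma stable_scale_tail:
  "(\<lambda>n. real n * sqrt (2 / pi) * exp (- (4/3) * ln (stable_scale n)) / sqrt (ln (stable_scale n)))
     \<longlonglongrightarrow> sqrt (8/3)"
proof -
  have "(\<lambda>n. real n * sqrt (2 / pi) * exp (- (4/3) * ln (stable_scale n)) / sqrt (ln (stable_scale n)))
     \<longlonglongrightarrow> sqrt (2 / pi) * sqrt (pi * (4/3))"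
  proof -
    have *: "exp (ln pi / 2) = sqrt pi"
      by (simp add: powr_half_sqrt[symmetric] powr_def)
    show ?thesis
      unfolding stable_scale_def
      by real_asymp (simp add: * sqrt_def[symmetric] powr_half_sqrt real_sqrt_mult real_sqrt_divide)
  qed
  also have "sqrt (2 / pi) * sqrt (pi * (4/3)) = sqrt (8/3)"
    by (simp add: real_sqrt_mult[symmetric])
  finally show ?thesis .
qed

section \<open>Perturbed scales and the corresponding Gaussian thresholds\<close>

definition sigma_at :: "real \<Rightarrow> nat \<Rightarrow> real" where
  "sigma_at u n = sqrt (8/3) + u / rate n"

lemma sigma_at_tendsto: "sigma_at u \<longlonglongrightarrow> sqrt (8/3)"
proof -
  have "(\<lambda>n. sqrt (8/3) + u / rate n) \<longlonglongrightarrow> sqrt (8/3) + 0"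
    by (intro tendsto_intros tendsto_divide_0[OF tendsto_const] filterlim_at_top_imp_at_infinity rate_at_top)
  then show ?thesis
    by (simp add: sigma_at_def[abs_def])
qed

lemma eventually_sigma_at: "eventually (\<lambda>n. sigma_at u n > 0 \<and> 1 / (sigma_at u n)\<^sup>2 < 1/2) sequentially"
proof -
  have "sqrt 2 < sqrt (8/3 :: real)"
    by (intro real_sqrt_less_mono) simp
  from order_tendstoD(1)[OF sigma_at_tendsto[of u] this]
  show ?thesis
  proof eventually_elim
    case (elim n)
    moreover have "0 < sqrt (2::real)"
      by simp
    ultimately have pos: "sigma_at u n > 0"
      by linarith
    have "(sqrt 2)\<^sup>2 < (sigma_at u n)\<^sup>2"
      using elim by (intro power_strict_mono) auto
    then show ?case
      using pos by (simp add: field_simps)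
  qed
qed

definition gaussian_threshold :: "real \<Rightarrow> nat \<Rightarrow> real" where
  "gaussian_threshold u n = sigma_at u n * sqrt (ln (stable_scale n))"

lemma gaussian_threshold_at_top: "filterlim (gaussian_threshold u) at_top sequentially"
  unfolding gaussian_threshold_def[abs_def]
  by (rule filterlim_tendsto_pos_mult_at_top[OF sigma_at_tendsto])
     (auto intro!: filterlim_compose[OF sqrt_at_top] ln_stable_scale_at_top)

lemma eventually_exp_gaussian_threshold:
  "eventually (\<lambda>n. exp (1 / (sigma_at u n)\<^sup>2 * (gaussian_threshold u n)\<^sup>2) = stable_scale n) sequentially"
  using eventually_sigma_at[of u] eventually_stable_scale_gt_1
proof eventually_elim
  case (elim n)
  then have "1 / (sigma_at u n)\<^sup>2 * (gaussian_threshold u n)\<^sup>2 = ln (stable_scale n)"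
    by (simp add: gaussian_threshold_def power_mult_distrib)
  then show ?case
    using elim by simp
qed

text \<open>\<open>A\<close> carries the tail exponent of the unperturbed scale and \<open>B\<close>
  the correction from \<open>sigma_at\<close>, including the factor \<open>1 / sigma_at u n\<close>.
  Their limits \<open>sqrt (8/3)\<close> and \<open>1 / sqrt (8/3)\<close> multiply to 1.\<close>

lemma gaussian_threshold_density:
  "(\<lambda>n. real n * (sqrt (2 / pi) * exp (- (gaussian_threshold u n)\<^sup>2 / 2) / gaussian_threshold u n)) \<longlonglongrightarrow> 1"
proof -
  define A where "A n = real n * sqrt (2 / pi) * exp (- (4/3) * ln (stable_scale n)) / sqrt (ln (stable_scale n))" for n
  define B where "B n = exp (- (u * (ln (stable_scale n) / rate n) * (sigma_at u n + sqrt (8/3)) / 2)) / sigma_at u n" for n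
  have "(\<lambda>n. A n * B n) \<longlonglongrightarrow> sqrt (8/3) * (exp (- (u * 0 * (sqrt (8/3) + sqrt (8/3)) / 2)) / sqrt (8/3))"
    unfolding A_def B_def by (intro tendsto_intros stable_scale_tail ln_stable_scale_over_rate sigma_at_tendsto) auto
  then have lim: "(\<lambda>n. A n * B n) \<longlonglongrightarrow> 1"
    by simp
  have "eventually (\<lambda>n. A n * B n
    = real n * (sqrt (2 / pi) * exp (- (gaussian_threshold u n)\<^sup>2 / 2) / gaussian_threshold u n)) sequentially"
    using eventually_stable_scale_gt_1
  proof eventually_elim
    case (elim n)
    define l where "l = ln (stable_scale n)"
    have l: "l \<ge> 0"
      using elim by (simp add: l_def)
    have sq: "(sqrt (8/3))\<^sup>2 = (8/3 :: real)"
      by (rule real_sqrt_pow2) simp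
    have "u / rate n * (sigma_at u n + sqrt (8/3)) = (sigma_at u n)\<^sup>2 - (sqrt (8/3))\<^sup>2"
      by (simp add: sigma_at_def power2_eq_square algebra_simps)
    then have d: "u / rate n * (sigma_at u n + sqrt (8/3)) = (sigma_at u n)\<^sup>2 - 8/3"
      unfolding sq .
    have "u * (l / rate n) * (sigma_at u n + sqrt (8/3)) / 2 = l * (u / rate n * (sigma_at u n + sqrt (8/3))) / 2"
      by simp
    also have "\<dots> = (gaussian_threshold u n)\<^sup>2 / 2 - 4/3 * l"
      unfolding d using l by (simp add: gaussian_threshold_def l_def[symmetric] power_mult_distrib field_simps)
    finally have e: "u * (l / rate n) * (sigma_at u n + sqrt (8/3)) / 2 = (gaussian_threshold u n)\<^sup>2 / 2 - 4/3 * l" .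
    have ee: "exp (- (4/3) * l) * exp (- ((gaussian_threshold u n)\<^sup>2 / 2 - 4/3 * l)) = exp (- (gaussian_threshold u n)\<^sup>2 / 2)"
      by (simp add: exp_add[symmetric])
    have "A n * B n = real n * sqrt (2 / pi) * (exp (- (4/3) * l) * exp (- ((gaussian_threshold u n)\<^sup>2 / 2 - 4/3 * l)))
        / (sqrt l * sigma_at u n)"
      unfolding A_def B_def l_def[symmetric] e by simp
    also have "real n * sqrt (2 / pi) * (exp (- (4/3) * l) * exp (- ((gaussian_threshold u n)\<^sup>2 / 2 - 4/3 * l)))
        / (sqrt l * sigma_at u n)
      = real n * (sqrt (2 / pi) * exp (- (gaussian_threshold u n)\<^sup>2 / 2) / (sigma_at u n * sqrt l))"
      unfolding ee by (simp add: mult.commute)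
    also have "sigma_at u n * sqrt l = gaussian_threshold u n"
      by (simp add: gaussian_threshold_def l_def)
    finally show ?case .
  qed
  then show ?thesis
    by (rule Lim_transform_eventually[OF lim])
qed

section \<open>First-order behaviour of the mean of the summands\<close>

lemma DERIV_psi2_mean:
  "((\<lambda>\<sigma>. 1 / sqrt (1 - 2 / \<sigma>\<^sup>2)) has_real_derivative - (pi powr (-(3/8)) / limit_factor)) (at (sqrt (8/3)))"
proof -
  have sq: "(sqrt (8/3))\<^sup>2 = (8/3 :: real)"
    by (rule real_sqrt_pow2) simp
  have half: "sqrt (1 - 2 / (sqrt (8/3))\<^sup>2) = (1/2 :: real)"
    unfolding sq by (intro real_sqrt_unique) (simp_all add: power2_eq_square)
  have "pi powr (-(3/8)) / limit_factor = sqrt (27/2)"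
  proof -
    have lf: "limit_factor = sqrt (2/27) * pi powr (-(3/8))"
      unfolding limit_factor_def
      by (rule real_sqrt_unique) (auto simp: power_mult_distrib powr_power powr_minus field_simps)
    show ?thesis
      unfolding lf by (simp add: real_sqrt_divide)
  qed
  \<comment> \<open>The left side has the shape produced by the chain rule, with 1/2 for the square
    root at the critical scale. It equals 16 over the cube of \<open>sqrt (8/3)\<close>.\<close>
  moreover have "1 / (1/2) * (1 / (1/2) / 2 * (4 / (sqrt (8/3)) ^ 3)) * (1 / (1/2)) = sqrt (27/2)"
  proof (rule real_sqrt_unique[symmetric])
    have "((sqrt (8/3)) ^ 3)\<^sup>2 = ((sqrt (8/3))\<^sup>2 :: real) ^ 3"
      by (simp only: power_mult[symmetric] mult.commute)
    then have "((sqrt (8/3)) ^ 3)\<^sup>2 = ((8/3) ^ 3 :: real)"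
      unfolding sq .
    then show "(1 / (1/2) * (1 / (1/2) / 2 * (4 / (sqrt (8/3)) ^ 3)) * (1 / (1/2)))\<^sup>2 = (27/2 :: real)"
      by (simp add: power_mult_distrib power_divide) (simp add: eval_nat_numeral)
  qed simp
  moreover have "((\<lambda>\<sigma>. inverse (sqrt (1 - 2 / \<sigma>\<^sup>2))) has_real_derivative
      - (1 / (1/2) * (1 / (1/2) / 2 * (4 / (sqrt (8/3)) ^ 3)) * (1 / (1/2)))) (at (sqrt (8/3)))"
  proof -
    have pos: "0 < 1 - 2 / (sqrt (8/3))\<^sup>2"
      unfolding sq by simp
    have "((\<lambda>\<sigma>. 1 - 2 / \<sigma>\<^sup>2) has_real_derivative 4 / (sqrt (8/3)) ^ 3) (at (sqrt (8/3)))"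
      by (auto intro!: derivative_eq_intros simp: field_simps eval_nat_numeral)
    from DERIV_inverse'[OF DERIV_chain'[OF this DERIV_real_sqrt[OF pos]]]
    show ?thesis
      unfolding half by (simp add: inverse_eq_divide)
  qed
  ultimately show ?thesis
    unfolding inverse_eq_divide by simp
qed

lemma psi2_mean_shift:
  "(\<lambda>n. real n * (1 / sqrt (1 - 2 / (sigma_at u n)\<^sup>2) - 2) / stable_scale n) \<longlonglongrightarrow> - u / limit_factor"
proof -
  define m where "m \<sigma> = 1 / sqrt (1 - 2 / \<sigma>\<^sup>2)" for \<sigma> :: real
  have sq: "(sqrt (8/3))\<^sup>2 = (8/3 :: real)"
    by (rule real_sqrt_pow2) simp
  have "sqrt (1 - 2 / (sqrt (8/3))\<^sup>2) = (1/2 :: real)"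
    unfolding sq by (intro real_sqrt_unique) (simp_all add: power2_eq_square)
  then have m2: "m (sqrt (8/3)) = 2"
    unfolding m_def by (simp only:) simp
  \<comment> \<open>The Caratheodory form of the derivative is an exact identity, so there is no
    remainder to estimate and \<open>u = 0\<close> needs no separate case.\<close>
  obtain D where D: "\<And>\<sigma>. m \<sigma> - m (sqrt (8/3)) = D \<sigma> * (\<sigma> - sqrt (8/3))"
    "isCont D (sqrt (8/3))" "D (sqrt (8/3)) = - (pi powr (-(3/8)) / limit_factor)"
    using DERIV_psi2_mean unfolding m_def[symmetric] CARAT_DERIV by blast
  have "(\<lambda>n. D (sigma_at u n) * u * (real n / (stable_scale n * rate n)))
     \<longlonglongrightarrow> D (sqrt (8/3)) * u * pi powr (3/8)"
    by (intro tendsto_intros scale_rate_balance isCont_tendsto_compose[OF D(2)] sigma_at_tendsto)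
  also have "D (sqrt (8/3)) * u * pi powr (3/8) = - u / limit_factor"
    by (simp add: D(3) powr_minus)
  finally show ?thesis
    unfolding m_def[symmetric]
    using D(1)[unfolded m2] by (simp add: sigma_at_def mult_ac)
qed

subsection \<open>Convergence of the normalised sums\<close>

text \<open>The characteristic function at \<open>c\<close> of exp (q Z^2) for a standard normal
  Z.\<close>

definition normal_exp_char :: "real \<Rightarrow> real \<Rightarrow> complex" where
  "normal_exp_char q c = (\<integral>y. std_normal_density y *\<^sub>R iexp (c * exp (q * y\<^sup>2)) \<partial>lborel)"

lemma norm_normal_exp_char_le_1: "norm (normal_exp_char q c) \<le> 1"
proof -
  have "norm (normal_exp_char q c) \<le> (\<integral>y. norm (std_normal_density y *\<^sub>R iexp (c * exp (q * y\<^sup>2))) \<partial>lborel)"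
    unfolding normal_exp_char_def by (rule integral_norm_bound)
  then show ?thesis
    by simp
qed

lemma normal_exp_char_eq:
  assumes q: "q < 1/2"
  shows "normal_exp_char q c = 1 + \<i> * of_real (c * (1 / sqrt (1 - 2 * q)))
    + (\<integral>y. std_normal_density y *\<^sub>R iexp_rem (c * exp (q * y\<^sup>2)) \<partial>lborel)"
proof -
  have e: "has_bochner_integral lborel (\<lambda>y. \<i> * of_real c * complex_of_real (std_normal_density y * exp (q * y\<^sup>2)))
      (\<i> * of_real c * of_real (1 / sqrt (1 - 2 * q)))"
    by (intro has_bochner_integral_mult_right has_bochner_integral_of_real has_bochner_integral_exp_square_normal q)
  have one: "has_bochner_integral lborel (\<lambda>y. complex_of_real (std_normal_density y)) (of_real 1)"
    by (intro has_bochner_integral_of_real) (simp add: has_bochner_integral_iff)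
  have rem: "has_bochner_integral lborel (\<lambda>y. std_normal_density y *\<^sub>R iexp_rem (c * exp (q * y\<^sup>2)))
    (\<integral>y. std_normal_density y *\<^sub>R iexp_rem (c * exp (q * y\<^sup>2)) \<partial>lborel)"
    using integrable_normal_iexp_rem[OF q] by (rule has_bochner_integral_integrable)
  have eq: "std_normal_density y *\<^sub>R iexp (c * exp (q * y\<^sup>2))
    = complex_of_real (std_normal_density y) + \<i> * of_real c * complex_of_real (std_normal_density y * exp (q * y\<^sup>2))
      + std_normal_density y *\<^sub>R iexp_rem (c * exp (q * y\<^sup>2))" for y
    by (simp add: iexp_rem_def scaleR_conv_of_real algebra_simps)
  have "has_bochner_integral lborel (\<lambda>y. std_normal_density y *\<^sub>R iexp (c * exp (q * y\<^sup>2)))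
     (of_real 1 + \<i> * of_real c * of_real (1 / sqrt (1 - 2 * q))
      + (\<integral>y. std_normal_density y *\<^sub>R iexp_rem (c * exp (q * y\<^sup>2)) \<partial>lborel))"
    unfolding eq by (intro has_bochner_integral_add one e rem)
  then show ?thesis
    unfolding normal_exp_char_def by (simp add: has_bochner_integral_iff)
qed

text \<open>Multiplying by the phase of the mean splits n (w - 1) into a purely deterministic part,
  of order n over the squared scale, and n times the Gaussian remainder integral, whose limit is the
  stable exponent.\<close>

lemma centered_normal_exp_char_power_tendsto:
  fixes s u :: real
  defines "m n \<equiv> 1 / sqrt (1 - 2 / (sigma_at u n)\<^sup>2)"
  shows "(\<lambda>n. (iexp (- (s / stable_scale n * m n)) * normal_exp_char (1 / (sigma_at u n)\<^sup>2) (s / stable_scale n)) ^ n)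
     \<longlonglongrightarrow> exp (\<integral>v. exp (- v) *\<^sub>R iexp_rem (s * exp (3/4 * v)) \<partial>lborel)"
proof (rule tendsto_power_exp)
  show "eventually (\<lambda>n. norm (iexp (- (s / stable_scale n * m n)) *
      normal_exp_char (1 / (sigma_at u n)\<^sup>2) (s / stable_scale n)) \<le> 1) sequentially"
    using norm_normal_exp_char_le_1 by (simp add: norm_mult del: of_real_minus of_real_mult of_real_divide)
  define L where "L = (\<integral>v. exp (- v) *\<^sub>R iexp_rem (s * exp (3/4 * v)) \<partial>lborel)"
  define G where "G n = (\<integral>y. std_normal_density y *\<^sub>R
      iexp_rem (s / stable_scale n * exp (1 / (sigma_at u n)\<^sup>2 * y\<^sup>2)) \<partial>lborel)" for n
  define \<delta> where "\<delta> n = s / stable_scale n * m n" for n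
  have sq: "(sqrt (8/3))\<^sup>2 = (8/3 :: real)"
    by (rule real_sqrt_pow2) simp
  have half: "sqrt (1 - 2 / (sqrt (8/3))\<^sup>2) = (1/2 :: real)"
    unfolding sq by (intro real_sqrt_unique) (simp_all add: power2_eq_square)
  have "(\<lambda>n. 1 / (sigma_at u n)\<^sup>2) \<longlonglongrightarrow> 1 / (sqrt (8/3))\<^sup>2"
    by (intro tendsto_intros sigma_at_tendsto) simp
  then have "(\<lambda>n. 1 / (sigma_at u n)\<^sup>2) \<longlonglongrightarrow> 3/8"
    unfolding sq by simp
  from normal_iexp_rem_limit[OF this gaussian_threshold_at_top[of u] gaussian_threshold_density, of s]
  have "(\<lambda>n. real n *\<^sub>R (\<integral>y. std_normal_density y *\<^sub>R
      iexp_rem (s / exp (1 / (sigma_at u n)\<^sup>2 * (gaussian_threshold u n)\<^sup>2) * exp (1 / (sigma_at u n)\<^sup>2 * y\<^sup>2)) \<partial>lborel))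
    \<longlonglongrightarrow> L"
    unfolding L_def .
  then have G: "(\<lambda>n. real n *\<^sub>R G n) \<longlonglongrightarrow> L"
    by (rule Lim_transform_eventually)
       (use eventually_exp_gaussian_threshold[of u] in eventually_elim, simp only: G_def)
  have m: "m \<longlonglongrightarrow> 2"
  proof -
    have "m \<longlonglongrightarrow> 1 / sqrt (1 - 2 / (sqrt (8/3))\<^sup>2)"
      unfolding m_def by (intro tendsto_intros sigma_at_tendsto; (simp only: half)?) simp_all
    then show ?thesis
      unfolding half by simp
  qed
  have sc: "(\<lambda>n. s / stable_scale n) \<longlonglongrightarrow> 0"
    by (intro tendsto_divide_0[OF tendsto_const] filterlim_at_top_imp_at_infinity stable_scale_at_top)
  have \<delta>: "\<delta> \<longlonglongrightarrow> 0"
    unfolding \<delta>_def using tendsto_mult[OF sc m] by simp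
  have "(\<lambda>n. s\<^sup>2 * (m n)\<^sup>2 / 2 * (real n / (stable_scale n)\<^sup>2)) \<longlonglongrightarrow> s\<^sup>2 * 2\<^sup>2 / 2 * 0"
    by (intro tendsto_intros m linear_over_stable_scale_square) simp
  also have "(\<lambda>n. s\<^sup>2 * (m n)\<^sup>2 / 2 * (real n / (stable_scale n)\<^sup>2)) = (\<lambda>n. real n * ((\<delta> n)\<^sup>2 / 2))"
    by (auto simp: \<delta>_def power_mult_distrib power_divide mult_ac)
  finally have n\<delta>: "(\<lambda>n. real n * ((\<delta> n)\<^sup>2 / 2)) \<longlonglongrightarrow> 0"
    by simp
  have "(\<lambda>n. of_nat n * (iexp (- \<delta> n) * (1 + \<i> * of_real (\<delta> n)) - 1)) \<longlonglongrightarrow> 0"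
  proof (rule Lim_null_comparison[OF always_eventually n\<delta>], rule allI)
    fix n
    \<comment> \<open>The deterministic part is itself a rotated second-order remainder, so the
      quadratic bound applies.\<close>
    have "iexp (- \<delta> n) * (1 + \<i> * of_real (\<delta> n)) - 1 = - (iexp (- \<delta> n) * iexp_rem (\<delta> n))"
      by (simp add: iexp_rem_def algebra_simps mult_exp_exp)
    then have "norm (iexp (- \<delta> n) * (1 + \<i> * of_real (\<delta> n)) - 1) = norm (iexp_rem (\<delta> n))"
      by (simp only: norm_minus_cancel norm_mult norm_exp_i_times mult_1)
    then show "norm (of_nat n * (iexp (- \<delta> n) * (1 + \<i> * of_real (\<delta> n)) - 1)) \<le> real n * ((\<delta> n)\<^sup>2 / 2)"
      using norm_iexp_rem_le_square[of "\<delta> n"] by (simp only: norm_mult norm_of_nat) (rule mult_left_mono, auto)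
  qed
  moreover have "(\<lambda>n. iexp (- \<delta> n) * (real n *\<^sub>R G n)) \<longlonglongrightarrow> iexp (- 0) * L"
    by (intro tendsto_intros \<delta> G)
  ultimately have lim: "(\<lambda>n. of_nat n * (iexp (- \<delta> n) * (1 + \<i> * of_real (\<delta> n)) - 1) + iexp (- \<delta> n) * (real n *\<^sub>R G n))
      \<longlonglongrightarrow> 0 + iexp (- 0) * L"
    by (rule tendsto_add)
  have "eventually (\<lambda>n. of_nat n * (iexp (- \<delta> n) * (1 + \<i> * of_real (\<delta> n)) - 1) + iexp (- \<delta> n) * (real n *\<^sub>R G n)
     = of_nat n * (iexp (- (s / stable_scale n * m n)) *
         normal_exp_char (1 / (sigma_at u n)\<^sup>2) (s / stable_scale n) - 1)) sequentially"
    using eventually_sigma_at[of u]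
  proof eventually_elim
    case (elim n)
    have "normal_exp_char (1 / (sigma_at u n)\<^sup>2) (s / stable_scale n) = 1 + \<i> * of_real (\<delta> n) + G n"
      using elim by (subst normal_exp_char_eq) (auto simp: \<delta>_def m_def G_def)
    then show ?case
      unfolding \<delta>_def[symmetric] by (simp add: scaleR_conv_of_real algebra_simps)
  qed
  from Lim_transform_eventually[OF lim this]
  show "(\<lambda>n. of_nat n * (iexp (- (s / stable_scale n * m n)) *
         normal_exp_char (1 / (sigma_at u n)\<^sup>2) (s / stable_scale n) - 1))
     \<longlonglongrightarrow> (\<integral>v. exp (- v) *\<^sub>R iexp_rem (s * exp (3/4 * v)) \<partial>lborel)"
    by (simp add: L_def)
qed

text \<open>
  The added \<open>u\<close> makes the limit law independent of \<open>u\<close>: it cancels the shift of the mean caused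
  by \<open>sigma_at u n\<close>.
\<close>

definition normalized_excess :: "real \<Rightarrow> nat \<Rightarrow> (nat \<Rightarrow> real) \<Rightarrow> real" where
  "normalized_excess u n x =
     (\<Sum>i=1..n. limit_factor * (exp (1 / (sigma_at u n)\<^sup>2 * (x i)\<^sup>2) - 2) / stable_scale n + u / real n)"

text \<open>The equivalence is exact and holds for all samples at once, so no linearisation of the
  empirical norm is involved. "Eventually" only secures positive scales, rates and n.\<close>

lemma eventually_empirical_orlicz_norm_le_iff:
  "eventually (\<lambda>n. \<forall>x. rate n * (empirical_orlicz_norm psi2 n x - sqrt (8/3)) \<le> u
     \<longleftrightarrow> normalized_excess u n x \<le> u) sequentially"
  using eventually_sigma_at[of u] eventually_stable_scale_gt_1 eventually_gt_at_top[of 0]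
    rate_at_top[unfolded filterlim_at_top_dense, THEN spec[of _ 0]]
proof eventually_elim
  case (elim n)
  show ?case
  proof
    fix x :: "nat \<Rightarrow> real"
    define T where "T = (\<Sum>i=1..n. exp (1 / (sigma_at u n)\<^sup>2 * (x i)\<^sup>2))"
    have "rate n * (empirical_orlicz_norm psi2 n x - sqrt (8/3)) \<le> u
        \<longleftrightarrow> empirical_orlicz_norm psi2 n x \<le> sigma_at u n"
      using elim by (simp add: sigma_at_def field_simps)
    also have "\<dots> \<longleftrightarrow> 1 / real n * (T - real n) \<le> 1"
      using elim by (subst empirical_orlicz_norm_psi2_le_iff)
        (simp_all add: T_def psi2_def power_divide sum_subtractf)
    also have "\<dots> \<longleftrightarrow> T - 2 * real n \<le> 0"
      using elim by (simp add: field_simps)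
    also have "\<dots> \<longleftrightarrow> limit_factor / stable_scale n * (T - 2 * real n) \<le> 0"
      using elim limit_factor_pos by (simp add: mult_le_0_iff divide_le_0_iff zero_le_divide_iff)
    also have "limit_factor / stable_scale n * (T - 2 * real n) = normalized_excess u n x - u"
      using elim by (simp add: normalized_excess_def T_def sum.distrib sum_subtractf
          sum_distrib_left[symmetric] sum_divide_distrib[symmetric])
    finally show "rate n * (empirical_orlicz_norm psi2 n x - sqrt (8/3)) \<le> u
        \<longleftrightarrow> normalized_excess u n x \<le> u"
      by simp
  qed
qed

section \<open>Characteristic functions of the summands and of their sums\<close>

lemma integral_std_normal_distributed:
  fixes f :: "real \<Rightarrow> complex"
  assumes X: "distributed M lborel X std_normal_density" and [measurable]: "f \<in> borel_measurable borel"
  shows "(\<integral>\<omega>. f (X \<omega>) \<partial>M) = (\<integral>y. std_normal_density y *\<^sub>R f y \<partial>lborel)"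
proof -
  have X': "distr M lborel X = density lborel std_normal_density" "X \<in> measurable M lborel"
    using X by (auto simp: distributed_def)
  have "(\<integral>\<omega>. f (X \<omega>) \<partial>M) = integral\<^sup>L (distr M lborel X) f"
    using X'(2) by (subst integral_distr) auto
  also have "\<dots> = (\<integral>y. std_normal_density y *\<^sub>R f y \<partial>lborel)"
    unfolding X'(1) by (subst integral_density) auto
  finally show ?thesis .
qed

lemma char_excess_summand:
  assumes X: "distributed M lborel X std_normal_density"
  shows "char (distr M borel (\<lambda>\<omega>. c * (exp (q * (X \<omega>)\<^sup>2) - 2) / a + d)) t
    = iexp (t * d - 2 * (t * c / a)) * normal_exp_char q (t * c / a)"
proof -
  have [measurable]: "X \<in> borel_measurable M"
    using X by (auto simp: distributed_def)
  have "char (distr M borel (\<lambda>\<omega>. c * (exp (q * (X \<omega>)\<^sup>2) - 2) / a + d)) t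
     = (\<integral>\<omega>. iexp (t * (c * (exp (q * (X \<omega>)\<^sup>2) - 2) / a + d)) \<partial>M)"
    unfolding char_def by (subst integral_distr) auto
  also have "\<dots> = (\<integral>y. std_normal_density y *\<^sub>R iexp (t * (c * (exp (q * y\<^sup>2) - 2) / a + d)) \<partial>lborel)"
    by (rule integral_std_normal_distributed[OF X]) auto
  also have "\<dots> = (\<integral>y. iexp (t * d - 2 * (t * c / a)) * (std_normal_density y *\<^sub>R iexp (t * c / a * exp (q * y\<^sup>2))) \<partial>lborel)"
  proof (rule Bochner_Integration.integral_cong[OF refl])
    fix y
    have "t * (c * (exp (q * y\<^sup>2) - 2) / a + d) = (t * d - 2 * (t * c / a)) + t * c / a * exp (q * y\<^sup>2)"
      by (cases "a = 0") (simp_all add: field_simps)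
    then have "iexp (t * (c * (exp (q * y\<^sup>2) - 2) / a + d))
      = iexp (t * d - 2 * (t * c / a)) * iexp (t * c / a * exp (q * y\<^sup>2))"
      by (simp only: of_real_add distrib_left exp_add)
    then show "std_normal_density y *\<^sub>R iexp (t * (c * (exp (q * y\<^sup>2) - 2) / a + d))
      = iexp (t * d - 2 * (t * c / a)) * (std_normal_density y *\<^sub>R iexp (t * c / a * exp (q * y\<^sup>2)))"
      by (simp only: mult_scaleR_right)
  qed
  also have "\<dots> = iexp (t * d - 2 * (t * c / a)) * normal_exp_char q (t * c / a)"
    unfolding normal_exp_char_def by (rule integral_mult_right_zero)
  finally show ?thesis .
qed

lemma char_affine:
  assumes [measurable]: "Y \<in> borel_measurable N"
  shows "char (distr N borel (\<lambda>\<omega>. c * (Y \<omega> - d))) t = iexp (- (t * c * d)) * char (distr N borel Y) (t * c)"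
proof -
  have "char (distr N borel (\<lambda>\<omega>. c * (Y \<omega> - d))) t = (\<integral>\<omega>. iexp (- (t * c * d)) * iexp (t * c * Y \<omega>) \<partial>N)"
    unfolding char_def
    by (subst integral_distr) (auto simp: mult_exp_exp algebra_simps intro!: Bochner_Integration.integral_cong)
  also have "\<dots> = iexp (- (t * c * d)) * (\<integral>\<omega>. iexp (t * c * Y \<omega>) \<partial>N)"
    by (rule integral_mult_right_zero)
  also have "(\<integral>\<omega>. iexp (t * c * Y \<omega>) \<partial>N) = char (distr N borel Y) (t * c)"
    unfolding char_def by (subst integral_distr) auto
  finally show ?thesis .
qed

text \<open>Independence gives an n-th power. The sum is centred at 2 per term, whereas the power
  limit is for centring at the true mean \<open>m n\<close>; the discrepancy and the added
  \<open>u\<close> are collected in the phase \<open>\<theta> n\<close>. Since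
  \<open>s = t * limit_factor\<close>, this phase tends to 0.\<close>

lemma (in prob_space) char_normalized_excess_tendsto:
  assumes indep: "indep_vars (\<lambda>_. borel) X {1..}"
    and X: "\<And>i. i \<ge> 1 \<Longrightarrow> distributed M lborel (X i) std_normal_density"
  shows "(\<lambda>n. char (distr M borel (\<lambda>\<omega>. normalized_excess u n (\<lambda>i. X i \<omega>))) t)
    \<longlonglongrightarrow> exp (\<integral>v. exp (- v) *\<^sub>R iexp_rem (t * limit_factor * exp (3/4 * v)) \<partial>lborel)"
proof -
  define s where "s = t * limit_factor"
  define m where "m n = 1 / sqrt (1 - 2 / (sigma_at u n)\<^sup>2)" for n
  define w where "w n = iexp (- (s / stable_scale n * m n)) *
      normal_exp_char (1 / (sigma_at u n)\<^sup>2) (s / stable_scale n)" for n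
  define \<theta> where "\<theta> n = t * u + s * (real n * (m n - 2) / stable_scale n)" for n
  have eq: "char (distr M borel (\<lambda>\<omega>. normalized_excess u n (\<lambda>i. X i \<omega>))) t = iexp (\<theta> n) * w n ^ n"
    if n: "n > 0" for n
  proof -
    let ?Z = "\<lambda>i \<omega>. limit_factor * (exp (1 / (sigma_at u n)\<^sup>2 * (X i \<omega>)\<^sup>2) - 2) / stable_scale n + u / real n"
    have "char (distr M borel (\<lambda>\<omega>. normalized_excess u n (\<lambda>i. X i \<omega>))) t
       = (\<Prod>i\<in>{1..n}. char (distr M borel (?Z i)) t)"
      unfolding normalized_excess_def
    proof (rule char_distr_sum)
      have "indep_vars (\<lambda>_. borel) X {1..n}"
        by (rule indep_vars_subset[OF indep]) auto
      then show "indep_vars (\<lambda>_. borel) ?Z {1..n}"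
        by (rule indep_vars_compose2) auto
    qed
    also have "\<dots> = (\<Prod>i\<in>{1..n}. iexp (t * (u / n) - 2 * (s / stable_scale n)) *
        normal_exp_char (1 / (sigma_at u n)\<^sup>2) (s / stable_scale n))"
      unfolding s_def by (intro prod.cong refl char_excess_summand X) auto
    also have "\<dots> = (iexp (t * (u / n) - 2 * (s / stable_scale n)) *
        normal_exp_char (1 / (sigma_at u n)\<^sup>2) (s / stable_scale n)) ^ n"
      by simp
    also have "iexp (t * (u / n) - 2 * (s / stable_scale n)) *
        normal_exp_char (1 / (sigma_at u n)\<^sup>2) (s / stable_scale n) = iexp (\<theta> n / n) * w n"
    proof -
      have "t * (u / n) - 2 * (s / stable_scale n) = \<theta> n / n + - (s / stable_scale n * m n)"
        using n by (simp add: \<theta>_def add_divide_distrib diff_divide_distrib algebra_simps)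
      then have "iexp (t * (u / n) - 2 * (s / stable_scale n))
        = iexp (\<theta> n / n) * iexp (- (s / stable_scale n * m n))"
        by (simp only: of_real_add distrib_left exp_add)
      then show ?thesis
        by (simp only: w_def mult.assoc)
    qed
    also have "(iexp (\<theta> n / n) * w n) ^ n = iexp (\<theta> n) * w n ^ n"
      using n by (simp add: power_mult_distrib exp_of_nat_mult[symmetric])
    finally show ?thesis .
  qed
  have "\<theta> \<longlonglongrightarrow> t * u + s * (- u / limit_factor)"
    unfolding \<theta>_def m_def by (intro tendsto_intros psi2_mean_shift)
  also have "t * u + s * (- u / limit_factor) = 0"
    using limit_factor_pos by (simp add: s_def)
  finally have \<theta>: "\<theta> \<longlonglongrightarrow> 0" .
  have "(\<lambda>n. iexp (\<theta> n) * w n ^ n) \<longlonglongrightarrow>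
      iexp 0 * exp (\<integral>v. exp (- v) *\<^sub>R iexp_rem (s * exp (3/4 * v)) \<partial>lborel)"
    unfolding w_def m_def
    by (intro tendsto_mult centered_normal_exp_char_power_tendsto tendsto_intros \<theta>)
  then have "(\<lambda>n. iexp (\<theta> n) * w n ^ n) \<longlonglongrightarrow>
      exp (\<integral>v. exp (- v) *\<^sub>R iexp_rem (s * exp (3/4 * v)) \<partial>lborel)"
    by simp
  then have "(\<lambda>n. char (distr M borel (\<lambda>\<omega>. normalized_excess u n (\<lambda>i. X i \<omega>))) t)
    \<longlonglongrightarrow> exp (\<integral>v. exp (- v) *\<^sub>R iexp_rem (s * exp (3/4 * v)) \<partial>lborel)"
    by (rule Lim_transform_eventually)
       (use eventually_gt_at_top[of 0] in eventually_elim, simp add: eq)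
  then show ?thesis
    by (simp add: s_def)
qed

theorem proposition3p4:
  fixes M :: "'a measure" and X :: "nat \<Rightarrow> 'a \<Rightarrow> real"
    and N :: "'b measure" and Y :: "'b \<Rightarrow> real"
  assumes "prob_space M"
    and "prob_space.indep_vars M (\<lambda>_. borel) X {1..}"
    and "\<And>i. i \<ge> 1 \<Longrightarrow> distributed M lborel (X i) std_normal_density"
    and "prob_space N"
    and "Y \<in> borel_measurable N"
    and "\<And>t::real. char (distr N borel Y) t =
           exp (4/3 * (CLBINT x:{0<..}.
             (exp (\<i> * of_real t * of_real x) - 1 - \<i> * of_real t * of_real x * indicator {..<1} x)
               * of_real (x powr (- (4/3) - 1))))"
  shows "weak_conv_m
     (\<lambda>n. distr M borel (\<lambda>\<omega>. real n powr (1/4) * ln (real n) powr (3/8) *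
        (empirical_orlicz_norm psi2 n (\<lambda>i. X i \<omega>) - orlicz_norm M psi2 (X 1))))
     (distr N borel (\<lambda>\<omega>. sqrt (2 / (27 * pi powr (3/4))) * (Y \<omega> - 4)))"
proof -
  interpret M: prob_space M by fact
  interpret N: prob_space N by fact
  note [measurable] = assms(5)
  have X [measurable]: "X i \<in> borel_measurable M" if "i \<ge> 1" for i
    using assms(3)[OF that] by (auto simp: distributed_def)
  define E where "E n \<omega> = rate n * (empirical_orlicz_norm psi2 n (\<lambda>i. X i \<omega>) - sqrt (8/3))" for n \<omega>
  define R where "R \<omega> = limit_factor * (Y \<omega> - 4)" for \<omega>
  have E [measurable]: "E n \<in> borel_measurable M" for n
    unfolding E_def[abs_def]
    by (intro borel_measurable_times borel_measurable_diff empirical_orlicz_norm_psi2_measurable) (auto intro: X)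
  have R [measurable]: "R \<in> borel_measurable N"
    unfolding R_def[abs_def] by measurable
  have charR: "char (distr N borel R) t
      = exp (\<integral>v. exp (- v) *\<^sub>R iexp_rem (t * limit_factor * exp (3/4 * v)) \<partial>lborel)" for t
  proof -
    \<comment> \<open>Subtracting 4 from Y produces exactly the phase that cancels the truncation
      term of the stable exponent.\<close>
    have "char (distr N borel R) t = iexp (- (t * limit_factor * 4)) * char (distr N borel Y) (t * limit_factor)"
      unfolding R_def[abs_def] by (rule char_affine) fact
    also have "char (distr N borel Y) (t * limit_factor)
      = exp ((\<integral>v. exp (- v) *\<^sub>R iexp_rem (t * limit_factor * exp (3/4 * v)) \<partial>lborel)
          + 4 * \<i> * of_real (t * limit_factor))"
      by (subst assms(6)) (simp only: stable_exponent_eq)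
    finally show ?thesis
      by (simp add: mult_exp_exp)
  qed
  have W: "(\<lambda>\<omega>. normalized_excess u n (\<lambda>i. X i \<omega>)) \<in> borel_measurable M" for u n
    unfolding normalized_excess_def by (intro borel_measurable_sum) (auto intro!: measurable_compose[OF X])
  have "weak_conv_m (\<lambda>n. distr M borel (E n)) (distr N borel R)"
    unfolding weak_conv_m_def weak_conv_def
  proof (intro allI impI)
    fix u assume u: "isCont (cdf (distr N borel R)) u"
    \<comment> \<open>The auxiliary sums depend on the level \<open>u\<close>, but their limit law
      does not. For each continuity point \<open>u\<close>, Levy's theorem is applied to the sums
      built for that \<open>u\<close>, and only the value of the cdf at \<open>u\<close> is
      used.\<close>
    have "weak_conv_m (\<lambda>n. distr M borel (\<lambda>\<omega>. normalized_excess u n (\<lambda>i. X i \<omega>))) (distr N borel R)"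
    proof (rule levy_continuity)
      show "(\<lambda>n. char (distr M borel (\<lambda>\<omega>. normalized_excess u n (\<lambda>i. X i \<omega>))) t)
          \<longlonglongrightarrow> char (distr N borel R) t" for t
        unfolding charR by (rule M.char_normalized_excess_tendsto) (use assms in auto)
    qed (auto intro!: M.real_distribution_distr N.real_distribution_distr W)
    with u have lim: "(\<lambda>n. cdf (distr M borel (\<lambda>\<omega>. normalized_excess u n (\<lambda>i. X i \<omega>))) u)
        \<longlonglongrightarrow> cdf (distr N borel R) u"
      by (simp add: weak_conv_m_def weak_conv_def)
    show "(\<lambda>n. cdf (distr M borel (E n)) u) \<longlonglongrightarrow> cdf (distr N borel R) u"
    proof (rule Lim_transform_eventually[OF lim])
      show "eventually (\<lambda>n. cdf (distr M borel (\<lambda>\<omega>. normalized_excess u n (\<lambda>i. X i \<omega>))) u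
          = cdf (distr M borel (E n)) u) sequentially"
        using eventually_empirical_orlicz_norm_le_iff[of u]
      proof eventually_elim
        case (elim n)
        have "(\<lambda>\<omega>. normalized_excess u n (\<lambda>i. X i \<omega>)) -` {..u} \<inter> space M = E n -` {..u} \<inter> space M"
          using elim by (auto simp: E_def)
        then show ?case
          using W by (simp add: cdf_def measure_distr)
      qed
    qed
  qed
  moreover have "orlicz_norm M psi2 (X 1) = sqrt (8/3)"
    by (rule orlicz_norm_psi2_std_normal) (rule assms(3), simp)
  ultimately show ?thesis
    by (simp only: E_def[abs_def] R_def[abs_def] rate_def limit_factor_def)
qed

end
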